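(* Let $\alpha$ be an uncountable regular cardinal. The forcing $\mathbb S^{\ast}(\alpha)$ is $\sigma$-closed. After adjoining a formal maximum condition, it is $\alpha$-strategically closed. Consequently, $\mathbb S^{\ast}(\alpha)$ is $<\alpha$-distributive and preserves $\alpha$ as a regular cardinal.
   Context: Notation. For a cardinal $\rho$ and a set $X$, $\mathcal P_\rho X=\{x\subseteq X:|x|<\rho\}$. A subset of $\mathcal P_\rho X$ is club if it is unbounded under inclusion and closed under unions of increasing sequences of positive length less than $\operatorname{cf}(\rho)$. A set $S$ of ordinals is nowhere stationary if $S\cap\beta$ is nonstationary in $\beta$ for every ordinal $\beta$ of uncountable cofinality. Binary sequences (functions from an ordinal to $2$) are ordered by extension; for a tree $t$ of binary sequences, $t_\xi$ is the set of nodes with domain $\xi$. A tree $t\subseteq{}^{\le\gamma}2$ is normal if it is nonempty, closed under initial segments, and every node has an extension on every higher level $\leq\gamma$. For $z\in\mathcal P_{\omega_1}\gamma$ put $\widehat z=\sup\{\xi+1:\xi\in z\}$ and $t[z]=\{r\restriction z:r\in t_{\widehat z}\}$. The symbol $-1$ is a formal "dummy" symbol that is not a binary function. The forcing $\mathbb S^{\ast}(\alpha)$ ($\alpha$ an uncountable regular cardinal). A condition is a tuple $p=\langle t_p,\ell_p,b_p,f_p\rangle$ with an ordinal $\gamma_p$, $\gamma_p+1<\alpha$, such that: (1) $t_p\subseteq{}^{\leq\gamma_p}2$ is a normal binary tree (of height $\gamma_p+1$). (2) $\ell_p$ is a function whose domain is a closed subset of $\gamma_p+1$; if $\xi\in\operatorname{dom}(\ell_p)$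 and $\operatorname{cf}(\xi)\leq\omega$ then $\ell_p(\xi)=\varnothing$; if $\operatorname{cf}(\xi)>\omega$ then for some $x\in(t_p)_\xi$ and some club $E_x\subseteq\mathcal P_{\omega_1}\xi$, $\ell_p(\xi)=\{x\}\cup\{x\restriction z:z\in E_x\}$. (3) $b_p:t_p\to(t_p)_{\gamma_p}$ and $v\subseteq b_p(v)$ for every $v\in t_p$. (4) $f_p$ is a partial function with $\operatorname{dom}(f_p)\subseteq\mathcal P_{\omega_1}\gamma_p$; $f_p(z)\in t_p[z]\cup\{-1\}$ for $z\in\operatorname{dom}(f_p)$; distinct members of $\operatorname{dom}(f_p)$ have distinct suprema; and $\{\sup z:z\in\operatorname{dom}(f_p),\ f_p(z)\neq-1\}$ is nowhere stationary. (5) $\operatorname{range}(f_p)\cap\ell_p(\xi)=\varnothing$ for every $\xi\in\operatorname{dom}(\ell_p)$. The order: $q\leq p$ iff (a) $t_q\cap{}^{\leq\gamma_p}2=t_p$; (b) $\ell_q$ extends $\ell_p$ and $\operatorname{dom}(\ell_q)\cap(\gamma_p+1)=\operatorname{dom}(\ell_p)$; (c) $b_p(v)\subseteq b_q(v)$ for every $v\in t_p$; (d) $f_q$ extends $f_p$ and every $z\in\operatorname{dom}(f_q)\setminus\operatorname{dom}(f_p)$ satisfies $\sup z>\gamma_p$. Forcing properties. A poset is $\sigma$-closed if every descending $\omega$-sequence has a lower bound. For a poset $P$ with maximum $\mathbf 1$, the game $G_\alpha(P)$ has $\alpha$ moves; players Odd and Even play conditions, Odd at odd stages and Even at even stages (including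 all limit stages), Even plays $\mathbf 1$ at stage $0$, and each move must be below all previous moves; a player who makes an illegal move (or cannot move legally) loses, and Even wins if neither player loses at any stage below $\alpha$. $P$ is $\alpha$-strategically closed if Even has a winning strategy in $G_\alpha(P)$. $P$ is $<\alpha$-distributive if the intersection of fewer than $\alpha$ dense open sets is dense; equivalently, forcing with $P$ adds no new sequences of ordinals of length less than $\alpha$. *)

theory Defs
  imports "HOL-Library.Countable_Set"
begin

text \<open>
  The cardinal \<open>\<alpha>\<close> is a type \<open>'a :: wellorder\<close> whose order relation \<open>ord_rel\<close> is an
  uncountable regular cardinal in the sense of the library (\<open>Card_order\<close>, \<open>regularCard\<close>,
  \<open>natLeq <o\<close>).  The elements of \<open>'a\<close> are the ordinals below \<open>\<alpha>\<close>, and an ordinal \<open>\<xi> < \<alpha>\<close>,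
  viewed as a set, is \<open>{..<\<xi>}\<close>.
\<close>

definition ord_rel :: "'a::wellorder rel" where
  "ord_rel = {(x, y). x \<le> y}"


unbundle cardinal_syntax

section \<open>Ordinals below \<open>\<alpha>\<close>\<close>

text \<open>The \<open>LEAST\<close> in the following definitions exists whenever they are used: \<open>\<alpha>\<close> is a limit
  ordinal greater than \<open>\<omega>\<close>, and \<open>osup\<close> is only applied to sets bounded below \<open>\<alpha>\<close>.\<close>

definition osucc :: "'a::wellorder \<Rightarrow> 'a" where
  "osucc \<xi> = (LEAST \<eta>. \<xi> < \<eta>)"

definition osup :: "'a::wellorder set \<Rightarrow> 'a" where
  "osup X = (LEAST \<delta>. \<forall>\<xi>\<in>X. \<xi> \<le> \<delta>)"

definition omega :: "'a::wellorder" where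
  "omega = (LEAST \<delta>. infinite {..<\<delta>})"

text \<open>Cofinality: the least \<open>\<delta>\<close> such that some function from \<open>\<delta>\<close> to \<open>\<xi>\<close> is cofinal in \<open>\<xi>\<close>
  (hence \<open>0\<close> at \<open>0\<close> and \<open>1\<close> at successors).\<close>

definition cf :: "'a::wellorder \<Rightarrow> 'a" where
  "cf \<xi> = (LEAST \<delta>. \<exists>h :: 'a \<Rightarrow> 'a. (\<forall>i<\<delta>. h i < \<xi>) \<and> (\<forall>\<eta><\<xi>. \<exists>i<\<delta>. \<eta> \<le> h i))"

definition limit_point :: "'a::wellorder set \<Rightarrow> 'a \<Rightarrow> bool" where
  "limit_point C \<delta> \<longleftrightarrow> (\<exists>\<eta>. \<eta> < \<delta>) \<and> (\<forall>\<eta><\<delta>. \<exists>\<xi>\<in>C. \<eta> < \<xi> \<and> \<xi> < \<delta>)"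

definition closed_in :: "'a::wellorder set \<Rightarrow> 'a \<Rightarrow> bool" where
  "closed_in C \<beta> \<longleftrightarrow> C \<subseteq> {..<\<beta>} \<and> (\<forall>\<delta><\<beta>. limit_point C \<delta> \<longrightarrow> \<delta> \<in> C)"

definition club_in :: "'a::wellorder set \<Rightarrow> 'a \<Rightarrow> bool" where
  "club_in C \<beta> \<longleftrightarrow> closed_in C \<beta> \<and> (\<forall>\<eta><\<beta>. \<exists>\<xi>\<in>C. \<eta> \<le> \<xi>)"

definition stationary_in :: "'a::wellorder set \<Rightarrow> 'a \<Rightarrow> bool" where
  "stationary_in S \<beta> \<longleftrightarrow> (\<forall>C. club_in C \<beta> \<longrightarrow> S \<inter> C \<noteq> {})"

text \<open>Only \<open>\<beta> < \<alpha>\<close> are quantified here.  The sets in question are bounded below \<open>\<alpha>\<close>, and a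
  bounded subset of an ordinal \<open>\<beta> \<ge> \<alpha>\<close> of uncountable cofinality is nonstationary in \<open>\<beta>\<close>.\<close>

definition nowhere_stationary :: "'a::wellorder set \<Rightarrow> bool" where
  "nowhere_stationary S \<longleftrightarrow> (\<forall>\<beta>. omega < cf \<beta> \<longrightarrow> \<not> stationary_in (S \<inter> {..<\<beta>}) \<beta>)"


section \<open>\<open>\<P>\<^sub>\<rho> X\<close> for \<open>\<rho> = \<omega>\<^sub>1\<close>\<close>

definition Pctbl :: "'a set \<Rightarrow> 'a set set" where
  "Pctbl X = {x. x \<subseteq> X \<and> countable x}"

text \<open>Since \<open>\<omega>\<^sub>1\<close> is regular, the lengths of the sequences in the definition of a club subset are
  the ordinals \<open>0 < \<delta> < \<omega>\<^sub>1\<close>; as \<open>\<alpha>\<close> is uncountable, all of them occur in \<open>'a\<close>.\<close>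

definition club_Pctbl :: "'a::wellorder set set \<Rightarrow> 'a set \<Rightarrow> bool" where
  "club_Pctbl E X \<longleftrightarrow>
     E \<subseteq> Pctbl X \<and>
     (\<forall>x\<in>Pctbl X. \<exists>y\<in>E. x \<subseteq> y) \<and>
     (\<forall>(\<delta>::'a) s. {..<\<delta>} \<noteq> {} \<and> countable {..<\<delta>} \<and> (\<forall>i<\<delta>. s i \<in> E) \<and>
        (\<forall>i j. i \<le> j \<and> j < \<delta> \<longrightarrow> s i \<subseteq> s j) \<longrightarrow> (\<Union>i\<in>{..<\<delta>}. s i) \<in> E)"


section \<open>Trees of binary sequences\<close>

text \<open>Binary functions are partial maps into \<open>bool\<close>; extension is \<open>\<subseteq>\<^sub>m\<close> and restriction is \<open>|`\<close>.\<close>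

type_synonym 'a bin = "'a \<rightharpoonup> bool"

definition seqs_upto :: "'a::wellorder \<Rightarrow> 'a bin set" where
  "seqs_upto \<gamma> = {v. \<exists>\<xi>\<le>\<gamma>. dom v = {..<\<xi>}}"

definition level :: "'a::wellorder bin set \<Rightarrow> 'a \<Rightarrow> 'a bin set" where
  "level t \<xi> = {v \<in> t. dom v = {..<\<xi>}}"

definition normal_tree :: "'a::wellorder \<Rightarrow> 'a bin set \<Rightarrow> bool" where
  "normal_tree \<gamma> t \<longleftrightarrow>
     t \<subseteq> seqs_upto \<gamma> \<and> t \<noteq> {} \<and>
     (\<forall>v\<in>t. \<forall>\<xi>. v |` {..<\<xi>} \<in> t) \<and>
     (\<forall>v\<in>t. \<forall>\<xi>\<le>\<gamma>. dom v \<subseteq> {..<\<xi>} \<longrightarrow> (\<exists>w\<in>level t \<xi>. v \<subseteq>\<^sub>m w))"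

definition hat :: "'a::wellorder set \<Rightarrow> 'a" where
  "hat z = osup (osucc ` z)"

definition trace :: "'a::wellorder bin set \<Rightarrow> 'a set \<Rightarrow> 'a bin set" where
  "trace t z = {r |` z | r. r \<in> level t (hat z)}"


section \<open>The forcing \<open>\<S>\<^sup>*(\<alpha>)\<close>\<close>

text \<open>\<open>Dummy\<close> is the symbol \<open>-1\<close>.\<close>

datatype 'a guess = Dummy | Bin "'a bin"

text \<open>The component \<open>ht\<close> is \<open>\<gamma>\<^sub>p\<close>.  It is determined by the tree, which has nodes on the levels
  \<open>\<xi> \<le> \<gamma>\<^sub>p\<close> and on no others, so recording it does not add information to the tuple.
  The requirement \<open>\<gamma>\<^sub>p + 1 < \<alpha>\<close> holds for every \<open>\<gamma>\<^sub>p :: 'a\<close>, because \<open>\<alpha>\<close> is a limit.\<close>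

record 'a cond =
  ht :: 'a
  tr :: "'a bin set"
  lb :: "'a \<rightharpoonup> 'a bin set"
  br :: "'a bin \<rightharpoonup> 'a bin"
  gs :: "'a set \<rightharpoonup> 'a guess"

definition label_ok :: "'a::wellorder bin set \<Rightarrow> 'a \<Rightarrow> 'a bin set \<Rightarrow> bool" where
  "label_ok t \<xi> L \<longleftrightarrow>
     (cf \<xi> \<le> omega \<longrightarrow> L = {}) \<and>
     (omega < cf \<xi> \<longrightarrow>
        (\<exists>x\<in>level t \<xi>. \<exists>E. club_Pctbl E {..<\<xi>} \<and> L = {x} \<union> {x |` z | z. z \<in> E}))"

definition S_star :: "'a::wellorder cond set" where
  "S_star = {p.
     normal_tree (ht p) (tr p) \<and>
     (closed_in (dom (lb p)) (osucc (ht p)) \<and>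
      (\<forall>\<xi> L. lb p \<xi> = Some L \<longrightarrow> label_ok (tr p) \<xi> L)) \<and>
     (dom (br p) = tr p \<and>
      (\<forall>v w. br p v = Some w \<longrightarrow> w \<in> level (tr p) (ht p) \<and> v \<subseteq>\<^sub>m w)) \<and>
     (dom (gs p) \<subseteq> Pctbl {..<ht p} \<and>
      (\<forall>z g. gs p z = Some g \<longrightarrow> g \<in> Bin ` trace (tr p) z \<union> {Dummy}) \<and>
      inj_on osup (dom (gs p)) \<and>
      nowhere_stationary {osup z | z. z \<in> dom (gs p) \<and> gs p z \<noteq> Some Dummy}) \<and>
     (\<forall>\<xi> L. lb p \<xi> = Some L \<longrightarrow> ran (gs p) \<inter> Bin ` L = {})}"

text \<open>\<open>S_le q p\<close> means that \<open>q\<close> is stronger than \<open>p\<close>.\<close>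

definition S_le :: "'a::wellorder cond \<Rightarrow> 'a cond \<Rightarrow> bool" where
  "S_le q p \<longleftrightarrow>
     tr q \<inter> seqs_upto (ht p) = tr p \<and>
     (lb p \<subseteq>\<^sub>m lb q \<and> dom (lb q) \<inter> {..<osucc (ht p)} = dom (lb p)) \<and>
     (\<forall>v\<in>tr p. the (br p v) \<subseteq>\<^sub>m the (br q v)) \<and>
     (gs p \<subseteq>\<^sub>m gs q \<and> (\<forall>z\<in>dom (gs q) - dom (gs p). ht p < osup z))"


section \<open>Forcing properties\<close>

text \<open>A forcing is given by its set \<open>P\<close> of conditions and its order \<open>le\<close>.\<close>

definition sigma_closed :: "'p set \<Rightarrow> ('p \<Rightarrow> 'p \<Rightarrow> bool) \<Rightarrow> bool" where
  "sigma_closed P le \<longleftrightarrow>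
     (\<forall>s :: nat \<Rightarrow> 'p. (\<forall>n. s n \<in> P) \<and> (\<forall>n. le (s (Suc n)) (s n)) \<longrightarrow>
        (\<exists>q\<in>P. \<forall>n. le q (s n)))"

text \<open>The formal maximum is \<open>None\<close>.\<close>

definition adjoin_top :: "'p set \<Rightarrow> 'p option set" where
  "adjoin_top P = insert None (Some ` P)"

definition adjoin_top_le :: "('p \<Rightarrow> 'p \<Rightarrow> bool) \<Rightarrow> 'p option \<Rightarrow> 'p option \<Rightarrow> bool" where
  "adjoin_top_le le q p \<longleftrightarrow>
     (case p of None \<Rightarrow> True | Some p' \<Rightarrow> (case q of None \<Rightarrow> False | Some q' \<Rightarrow> le q' p'))"

text \<open>An ordinal is even if it is \<open>\<lambda> + 2n\<close> with \<open>\<lambda>\<close> zero or a limit.\<close>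

inductive even_stage :: "'a::wellorder \<Rightarrow> bool" where
  nonsucc: "(\<nexists>\<eta>. \<xi> = osucc \<eta>) \<Longrightarrow> even_stage \<xi>"
| step: "even_stage \<xi> \<Longrightarrow> even_stage (osucc (osucc \<xi>))"

text \<open>A run of the game is a sequence of moves \<open>x\<close> indexed by the stages below \<open>\<alpha>\<close>.  The run is
  decided at the first illegal move, and the entries after that are irrelevant; a player
  who cannot move legally is one all of whose moves are illegal.\<close>

definition legal_at ::
    "'p set \<Rightarrow> ('p \<Rightarrow> 'p \<Rightarrow> bool) \<Rightarrow> 'p \<Rightarrow> ('a::wellorder \<Rightarrow> 'p) \<Rightarrow> 'a \<Rightarrow> bool" where
  "legal_at P le one x \<xi> \<longleftrightarrow>
     x \<xi> \<in> P \<and> (\<forall>\<eta><\<xi>. le (x \<xi>) (x \<eta>)) \<and> ((\<forall>\<eta>. \<xi> \<le> \<eta>) \<longrightarrow> x \<xi> = one)"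

definition first_illegal ::
    "'p set \<Rightarrow> ('p \<Rightarrow> 'p \<Rightarrow> bool) \<Rightarrow> 'p \<Rightarrow> ('a::wellorder \<Rightarrow> 'p) \<Rightarrow> 'a \<Rightarrow> bool" where
  "first_illegal P le one x \<xi> \<longleftrightarrow>
     \<not> legal_at P le one x \<xi> \<and> (\<forall>\<eta><\<xi>. legal_at P le one x \<eta>)"

definition even_wins ::
    "'p set \<Rightarrow> ('p \<Rightarrow> 'p \<Rightarrow> bool) \<Rightarrow> 'p \<Rightarrow> ('a::wellorder \<Rightarrow> 'p) \<Rightarrow> bool" where
  "even_wins P le one x \<longleftrightarrow> (\<forall>\<xi>. first_illegal P le one x \<xi> \<longrightarrow> \<not> even_stage \<xi>)"

text \<open>A strategy for Even maps a partial play, given as a sequence with domain \<open>{..<\<xi>}\<close>, to a move.\<close>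

definition strategically_closed ::
    "'a::wellorder itself \<Rightarrow> 'p set \<Rightarrow> ('p \<Rightarrow> 'p \<Rightarrow> bool) \<Rightarrow> 'p \<Rightarrow> bool" where
  "strategically_closed (_ :: 'a itself) P le one \<longleftrightarrow>
     (\<exists>\<sigma> :: ('a \<rightharpoonup> 'p) \<Rightarrow> 'p. \<forall>x :: 'a \<Rightarrow> 'p.
        (\<forall>\<xi>. even_stage \<xi> \<longrightarrow> x \<xi> = \<sigma> ((\<lambda>\<eta>. Some (x \<eta>)) |` {..<\<xi>})) \<longrightarrow> even_wins P le one x)"

definition dense_in :: "'p set \<Rightarrow> ('p \<Rightarrow> 'p \<Rightarrow> bool) \<Rightarrow> 'p set \<Rightarrow> bool" where
  "dense_in P le D \<longleftrightarrow> D \<subseteq> P \<and> (\<forall>p\<in>P. \<exists>d\<in>D. le d p)"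

definition open_in :: "'p set \<Rightarrow> ('p \<Rightarrow> 'p \<Rightarrow> bool) \<Rightarrow> 'p set \<Rightarrow> bool" where
  "open_in P le D \<longleftrightarrow> D \<subseteq> P \<and> (\<forall>d\<in>D. \<forall>q\<in>P. le q d \<longrightarrow> q \<in> D)"

text \<open>The intersection is relative to \<open>P\<close>, so that the empty family has intersection \<open>P\<close>.\<close>

definition distributive_below :: "'a rel \<Rightarrow> 'p set \<Rightarrow> ('p \<Rightarrow> 'p \<Rightarrow> bool) \<Rightarrow> bool" where
  "distributive_below \<kappa> P le \<longleftrightarrow>
     (\<forall>\<D>. |\<D>| <o \<kappa> \<and> (\<forall>D\<in>\<D>. dense_in P le D \<and> open_in P le D) \<longrightarrow> dense_in P le (P \<inter> \<Inter>\<D>))"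


section \<open>The forcing relation and preservation of \<open>\<alpha>\<close>\<close>

text \<open>A statement of the forcing language is represented by the predicate ``\<open>p\<close> forces it'' on
  conditions, and the connectives are the recursive clauses of the forcing relation.  A subset
  of a ground model set \<open>X\<close> in the extension is given by a name of the form
  \<open>\<tau> \<subseteq> P \<times> X\<close>, where \<open>(s, x) \<in> \<tau>\<close> stands for the pair of the canonical name of \<open>x\<close> and \<open>s\<close>; every
  subset of \<open>X\<close> in a generic extension has such a name.  The ordinals below \<open>\<alpha>\<close> are those of the
  ground model, and so is their order; \<open>f_ground b\<close> is the statement \<open>b\<close> about the
  ground model.\<close>

type_synonym 'p fstmt = "'p \<Rightarrow> bool"

definition f_ground :: "bool \<Rightarrow> 'p fstmt" where
  "f_ground b = (\<lambda>p. b)"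

definition f_in :: "'p set \<Rightarrow> ('p \<Rightarrow> 'p \<Rightarrow> bool) \<Rightarrow> 'x \<Rightarrow> ('p \<times> 'x) set \<Rightarrow> 'p fstmt" where
  "f_in P le x \<tau> = (\<lambda>p. \<forall>q\<in>P. le q p \<longrightarrow> (\<exists>r\<in>P. le r q \<and> (\<exists>s\<in>P. le r s \<and> (s, x) \<in> \<tau>)))"

definition f_not :: "'p set \<Rightarrow> ('p \<Rightarrow> 'p \<Rightarrow> bool) \<Rightarrow> 'p fstmt \<Rightarrow> 'p fstmt" where
  "f_not P le \<phi> = (\<lambda>p. \<forall>q\<in>P. le q p \<longrightarrow> \<not> \<phi> q)"

definition f_and :: "'p fstmt \<Rightarrow> 'p fstmt \<Rightarrow> 'p fstmt" where
  "f_and \<phi> \<psi> = (\<lambda>p. \<phi> p \<and> \<psi> p)"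

definition f_all :: "('x \<Rightarrow> 'p fstmt) \<Rightarrow> 'p fstmt" where
  "f_all \<Phi> = (\<lambda>p. \<forall>x. \<Phi> x p)"

definition f_imp :: "'p set \<Rightarrow> ('p \<Rightarrow> 'p \<Rightarrow> bool) \<Rightarrow> 'p fstmt \<Rightarrow> 'p fstmt \<Rightarrow> 'p fstmt" where
  "f_imp P le \<phi> \<psi> = f_not P le (f_and \<phi> (f_not P le \<psi>))"

definition f_ex :: "'p set \<Rightarrow> ('p \<Rightarrow> 'p \<Rightarrow> bool) \<Rightarrow> ('x \<Rightarrow> 'p fstmt) \<Rightarrow> 'p fstmt" where
  "f_ex P le \<Phi> = f_not P le (f_all (\<lambda>x. f_not P le (\<Phi> x)))"

text \<open>``\<open>\<tau>\<close> is a function from \<open>\<beta>\<close> to \<open>\<alpha>\<close>''\<close>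

definition f_function ::
    "'p set \<Rightarrow> ('p \<Rightarrow> 'p \<Rightarrow> bool) \<Rightarrow> ('p \<times> ('a::wellorder \<times> 'a)) set \<Rightarrow> 'a \<Rightarrow> 'p fstmt" where
  "f_function P le \<tau> \<beta> =
     f_and (f_all (\<lambda>\<xi>. f_all (\<lambda>\<eta>. f_imp P le (f_in P le (\<xi>, \<eta>) \<tau>) (f_ground (\<xi> < \<beta>)))))
    (f_and (f_all (\<lambda>\<xi>. f_imp P le (f_ground (\<xi> < \<beta>)) (f_ex P le (\<lambda>\<eta>. f_in P le (\<xi>, \<eta>) \<tau>))))
           (f_all (\<lambda>\<xi>. f_all (\<lambda>\<eta>. f_all (\<lambda>\<eta>'.
              f_imp P le (f_and (f_in P le (\<xi>, \<eta>) \<tau>) (f_in P le (\<xi>, \<eta>') \<tau>))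
                (f_ground (\<eta> = \<eta>')))))))"

text \<open>``\<open>\<alpha>\<close> is a cardinal'': no function from an ordinal \<open>\<beta> < \<alpha>\<close> to \<open>\<alpha>\<close> is onto\<close>

definition f_cardinal :: "'a::wellorder itself \<Rightarrow> 'p set \<Rightarrow> ('p \<Rightarrow> 'p \<Rightarrow> bool) \<Rightarrow> 'p fstmt" where
  "f_cardinal (_ :: 'a itself) P le =
     f_all (\<lambda>\<beta> :: 'a. f_all (\<lambda>\<tau>. f_imp P le (f_function P le \<tau> \<beta>)
       (f_not P le (f_all (\<lambda>\<eta>. f_ex P le (\<lambda>\<xi>. f_in P le (\<xi>, \<eta>) \<tau>))))))"

text \<open>``\<open>cf(\<alpha>) = \<alpha>\<close>'': every function from an ordinal \<open>\<beta> < \<alpha>\<close> to \<open>\<alpha>\<close> is bounded in \<open>\<alpha>\<close>\<close>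

definition f_regular :: "'a::wellorder itself \<Rightarrow> 'p set \<Rightarrow> ('p \<Rightarrow> 'p \<Rightarrow> bool) \<Rightarrow> 'p fstmt" where
  "f_regular (_ :: 'a itself) P le =
     f_all (\<lambda>\<beta> :: 'a. f_all (\<lambda>\<tau>. f_imp P le (f_function P le \<tau> \<beta>)
       (f_ex P le (\<lambda>\<delta>. f_all (\<lambda>\<xi>. f_all (\<lambda>\<eta>.
          f_imp P le (f_in P le (\<xi>, \<eta>) \<tau>) (f_ground (\<eta> < \<delta>))))))))"

definition preserves_regular_cardinal ::
    "'a::wellorder itself \<Rightarrow> 'p set \<Rightarrow> ('p \<Rightarrow> 'p \<Rightarrow> bool) \<Rightarrow> bool" where
  "preserves_regular_cardinal \<alpha> P le \<longleftrightarrow>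
     (\<forall>p\<in>P. f_and (f_cardinal \<alpha> P le) (f_regular \<alpha> P le) p)"

end

theory Submission
  imports Defs
begin

text \<open>
  A descending chain of conditions has a lower bound whose height \<open>\<gamma>\<close> is the strict supremum of the
  heights in the chain, unless \<open>\<gamma>\<close> has uncountable cofinality and the suprema of the non-dummy guessed
  sets are stationary in \<open>\<gamma>\<close>: one tops the union of the trees with the unions of the chosen branches,
  and a club of \<open>\<gamma>\<close> avoiding these suprema supplies a label for \<open>\<gamma>\<close>.  For countable chains the
  exception does not arise.  In the game, Even always plays such a lower bound of all previous
  conditions.  No guessed set has the height of one of these lower bounds as its supremum, as guesses
  made later have larger suprema; and the heights are continuous at limit stages, so they form a club
  that rules out the exception.
\<close>

section \<open>Ordinals below a regular cardinal\<close>

text \<open>The component \<open>br\<close> is what allows the union of the trees to be capped: a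
  node of the union need not have an obvious branch through all levels, but the branches chosen for
  it by the conditions cohere. A strict supremum is taken so that a new level appears even if the
  chain has a strongest member; heights then grow strictly at Even's moves, and a successor height
  has countable cofinality, so the empty label suffices there. The new height is always labelled,
  because old labels may accumulate at it and their domain must be closed. Nonstationarity at the
  new height serves two clauses at once: it is the only new instance of the nowhere stationary
  requirement that can fail, and its witnessing club makes the new label disjoint from all guesses.
  The last two claims use nothing specific to this forcing. Odd enters prescribed dense open sets
  during a play won by Even, which gives distributivity; distributivity bounds every function in the
  extension from a smaller ordinal to \<alpha> by an ordinal, and this excludes surjections and
  unbounded functions alike.\<close>

lemma Field_ord_rel [simp]: "Field (ord_rel :: 'a::wellorder rel) = UNIV"
  by (auto simp: Field_def ord_rel_def)

lemma underS_ord_rel: "underS (ord_rel :: 'a::wellorder rel) \<xi> = {..<\<xi>}"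
  by (auto simp: underS_def ord_rel_def)

locale regular_uncountable =
  fixes dummy :: "'a::wellorder itself"
  assumes card: "Card_order (ord_rel :: 'a rel)"
    and regular: "regularCard (ord_rel :: 'a rel)"
    and uncountable: "natLeq <o (ord_rel :: 'a rel)"
begin

text \<open>Since \<open>natLeq\<close> is strictly smaller, it is isomorphic to a proper initial
  segment of \<alpha>. This makes the \<open>LEAST\<close> in \<open>omega\<close>
  meaningful.\<close>

lemma ex_infinite: "\<exists>\<delta>::'a. infinite {..<\<delta>}"
proof -
  have wo: "Well_order (ord_rel :: 'a rel)"
    using card by (rule card_order_on_well_order_on)
  obtain a :: 'a where a: "natLeq =o Restr ord_rel (underS ord_rel a)"
    using uncountable ordLess_iff_ordIso_Restr[OF wo natLeq_Well_order] by blast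
  have "Field (Restr ord_rel (underS (ord_rel :: 'a rel) a)) = underS ord_rel a"
    by (auto simp: Field_def ord_rel_def underS_def)
  moreover obtain f where "bij_betw f (Field natLeq) (Field (Restr ord_rel (underS ord_rel a)))"
    using a by (auto simp: ordIso_def iso_def)
  ultimately have "bij_betw f UNIV {..<a}"
    by (simp add: Field_natLeq underS_ord_rel)
  then show ?thesis
    using bij_betw_finite by blast
qed

text \<open>An infinite cardinal is a limit ordinal; this makes the \<open>LEAST\<close> in
  \<open>osucc\<close> meaningful.\<close>

lemma ex_gt: "\<exists>\<eta>::'a. \<xi> < \<eta>"
proof -
  have "infinite (UNIV :: 'a set)"
    by (metis ex_infinite finite_subset subset_UNIV)
  then obtain b :: 'a where "\<xi> \<noteq> b" "(\<xi>, b) \<in> ord_rel"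
    using infinite_Card_order_limit[OF card, of \<xi>] by auto
  then show ?thesis
    by (metis (mono_tags, lifting) case_prodD le_neq_trans mem_Collect_eq ord_rel_def)
qed

lemma less_osucc [simp]: "(\<eta>::'a) < osucc \<xi> \<longleftrightarrow> \<eta> \<le> \<xi>"
proof -
  have "\<xi> < osucc \<xi>"
    unfolding osucc_def using ex_gt by (rule LeastI_ex)
  moreover have "\<eta> \<le> \<xi>" if "\<eta> < osucc \<xi>"
    using that not_less_Least unfolding osucc_def by force
  ultimately show ?thesis
    by auto
qed

lemma osucc_le [simp]: "osucc (\<xi>::'a) \<le> \<eta> \<longleftrightarrow> \<xi> < \<eta>"
  by (meson less_osucc not_le)

lemma osucc_eq_iff [simp]: "osucc (\<xi>::'a) = osucc \<eta> \<longleftrightarrow> \<xi> = \<eta>"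
  by (metis less_osucc order.eq_iff)

text \<open>The bound \<open>b\<close> guarantees that the \<open>LEAST\<close> in
  \<open>hat\<close> exists. As a strict supremum, \<open>hat\<close> is applied to sets of heights
  as well as to guessed sets.\<close>

lemma less_hat:
  assumes "\<And>\<eta>::'a. \<eta> \<in> X \<Longrightarrow> \<eta> < b" "\<xi> \<in> X"
  shows "\<xi> < hat X"
proof -
  have "\<exists>\<delta>. \<forall>\<zeta>\<in>osucc ` X. \<zeta> \<le> \<delta>"
    using assms(1) by (auto intro!: exI[of _ b])
  from LeastI_ex[OF this] assms(2) show ?thesis
    by (auto simp: hat_def osup_def)
qed

lemma hat_le:
  assumes "\<And>\<eta>::'a. \<eta> \<in> X \<Longrightarrow> \<eta> < b"
  shows "hat X \<le> b"
  unfolding hat_def osup_def using assms by (intro Least_le) auto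

lemma less_hatD: "(\<eta>::'a) < hat X \<Longrightarrow> \<exists>\<xi>\<in>X. \<eta> \<le> \<xi>"
  by (meson hat_le not_le)

lemma osup_le:
  assumes "\<And>\<eta>::'a. \<eta> \<in> X \<Longrightarrow> \<eta> \<le> b"
  shows "osup X \<le> b"
  unfolding osup_def using assms by (intro Least_le) auto

lemma le_osup:
  assumes "\<And>\<eta>::'a. \<eta> \<in> X \<Longrightarrow> \<eta> \<le> b" "\<xi> \<in> X"
  shows "\<xi> \<le> osup X"
proof -
  have "\<exists>\<delta>. \<forall>\<zeta>\<in>X. \<zeta> \<le> \<delta>"
    using assms(1) by auto
  from LeastI_ex[OF this] assms(2) show ?thesis
    by (auto simp: osup_def)
qed

lemma card_lessThan: "|{..<\<xi>::'a}| <o (ord_rel :: 'a rel)"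
proof -
  have "\<xi> \<in> Field (ord_rel :: 'a rel)"
    by simp
  from card_of_underS[OF card this] show ?thesis
    by (simp add: underS_ord_rel)
qed

text \<open>By regularity a cofinal subset has the cardinality of \<alpha>, so a smaller set is not
  cofinal; one further step up makes the bound strict.\<close>

lemma small_bounded:
  assumes "|X| <o (ord_rel :: 'a rel)"
  shows "\<exists>b. \<forall>\<xi>\<in>X. \<xi> < (b::'a)"
proof -
  have "\<not> cofinal X (ord_rel :: 'a rel)"
    using regular assms not_ordLess_ordIso unfolding regularCard_def by auto
  then obtain a :: 'a where "\<forall>\<xi>\<in>X. \<xi> \<le> a"
    unfolding cofinal_def ord_rel_def by force
  moreover obtain b where "a < b"
    using ex_gt by blast
  ultimately show ?thesis
    by (meson le_less_trans)
qed

lemma image_bounded: "\<exists>b. \<forall>\<eta><\<xi>::'a. f \<eta> < (b::'a)"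
  using small_bounded[OF ordLeq_ordLess_trans[OF card_of_image card_lessThan], of f \<xi>] by auto

lemma countable_bounded:
  assumes "countable X"
  shows "\<exists>b. \<forall>\<xi>\<in>X. \<xi> < (b::'a)"
proof (rule small_bounded)
  have "|X| \<le>o natLeq"
    using assms card_of_ordLeq[of X "UNIV :: nat set"] card_of_nat ordLeq_ordIso_trans
    unfolding countable_def by blast
  then show "|X| <o (ord_rel :: 'a rel)"
    using uncountable by (rule ordLeq_ordLess_trans)
qed

text \<open>The index set \<open>nat\<close> is replaced by \<open>{..<omega}\<close> through the
  inverse of an injection of \<open>nat\<close> into this infinite set; indices outside the range
  still give values of \<open>f\<close>. A constant \<open>f\<close> covers successor
  ordinals.\<close>

lemma cf_le_omega:
  fixes f :: "nat \<Rightarrow> 'a"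
  assumes "\<And>n. f n < \<xi>" "\<And>\<eta>. \<eta> < \<xi> \<Longrightarrow> \<exists>n. \<eta> \<le> f n"
  shows "cf \<xi> \<le> omega"
proof -
  have "infinite {..<omega::'a}"
    unfolding omega_def using ex_infinite by (rule LeastI_ex)
  then obtain g :: "nat \<Rightarrow> 'a" where g: "inj g" "range g \<subseteq> {..<omega}"
    using infinite_countable_subset by meson
  have "\<exists>i < omega. \<eta> \<le> f (inv g i)" if "\<eta> < \<xi>" for \<eta>
  proof -
    obtain n where "\<eta> \<le> f n"
      using assms(2) \<open>\<eta> < \<xi>\<close> by blast
    then show ?thesis
      using g by (intro exI[of _ "g n"]) auto
  qed
  then show ?thesis
    unfolding cf_def using assms(1) by (intro Least_le exI[of _ "\<lambda>i. f (inv g i)"]) auto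
qed

lemma even_or_even_osucc: "even_stage \<xi> \<or> even_stage (osucc (\<xi>::'a))"
proof (induction \<xi> rule: less_induct)
  case (less \<xi>)
  show ?case
  proof (cases "\<exists>\<eta>. \<xi> = osucc \<eta>")
    case True
    then obtain \<eta> where \<eta>: "\<xi> = osucc \<eta>"
      by blast
    then have "\<eta> < \<xi>"
      by simp
    from less.IH[OF this] \<eta> show ?thesis
      by (auto intro: even_stage.step)
  qed (auto intro: even_stage.nonsucc)
qed

lemma not_even_osucc: "even_stage \<xi> \<Longrightarrow> \<not> even_stage (osucc (\<xi>::'a))"
proof (induction rule: even_stage.induct)
  case (nonsucc \<xi>)
  show ?case
  proof
    assume "even_stage (osucc \<xi>)"
    then show False
      by cases (use nonsucc in auto)
  qed
next
  case (step \<xi>)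
  show ?case
  proof
    assume "even_stage (osucc (osucc (osucc \<xi>)))"
    then show False
      by cases (use step in auto)
  qed
qed

end

section \<open>Unions of chains of partial maps\<close>

text \<open>Conflicting values are resolved by choice to keep the operator total; for a chain under
  \<open>\<subseteq>\<^sub>m\<close> it is the union.\<close>

definition map_Sup :: "('x \<rightharpoonup> 'y) set \<Rightarrow> ('x \<rightharpoonup> 'y)" where
  "map_Sup F x = (if \<exists>y. \<exists>m\<in>F. m x = Some y then Some (SOME y. \<exists>m\<in>F. m x = Some y) else None)"

lemma map_Sup_eq_Some_iff:
  assumes "\<And>m n. m \<in> F \<Longrightarrow> n \<in> F \<Longrightarrow> m \<subseteq>\<^sub>m n \<or> n \<subseteq>\<^sub>m m"
  shows "map_Sup F x = Some y \<longleftrightarrow> (\<exists>m\<in>F. m x = Some y)"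
proof -
  have unique: "y = y'" if "m \<in> F" "m x = Some y" "n \<in> F" "n x = Some y'" for m n y y'
  proof -
    have "m x = n x"
      using assms[OF that(1,3)] that(2,4) by (metis domI map_le_def)
    with that show ?thesis
      by simp
  qed
  show ?thesis
  proof
    assume "map_Sup F x = Some y"
    then have "\<exists>y. \<exists>m\<in>F. m x = Some y" "(SOME y. \<exists>m\<in>F. m x = Some y) = y"
      by (auto simp: map_Sup_def split: if_splits)
    then show "\<exists>m\<in>F. m x = Some y"
      using someI_ex[of "\<lambda>y. \<exists>m\<in>F. m x = Some y"] by simp
  next
    assume y: "\<exists>m\<in>F. m x = Some y"
    then have "(SOME y. \<exists>m\<in>F. m x = Some y) = y"
      by (rule some_equality) (use y unique in blast)
    with y show "map_Sup F x = Some y"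
      by (auto simp: map_Sup_def)
  qed
qed

section \<open>The forcing order\<close>

lemma lessThan_eq_lessThan_iff: "{..<\<xi>} = {..<\<eta>} \<longleftrightarrow> \<xi> = (\<eta>::'a::linorder)"
  by (metis lessThan_iff linorder_neqE order_less_irrefl)

lemma level_nonempty:
  assumes "normal_tree \<gamma> t" "\<xi> \<le> \<gamma>"
  shows "level t \<xi> \<noteq> {}"
proof -
  obtain v where "v \<in> t"
    using assms(1) by (auto simp: normal_tree_def)
  then have "v |` {..<\<xi>} \<in> t" "dom (v |` {..<\<xi>}) \<subseteq> {..<\<xi>}"
    using assms(1) by (auto simp: normal_tree_def)
  then show ?thesis
    using assms unfolding normal_tree_def by blast
qed

text \<open>The order does not mention heights. They are compared through a node on the top level of
  \<open>tr p\<close>, which has to occur in \<open>tr q\<close>.\<close>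

lemma S_le_ht:
  assumes "p \<in> S_star" "q \<in> S_star" "S_le q p"
  shows "ht p \<le> ht q"
proof -
  obtain v where v: "v \<in> tr p" "dom v = {..<ht p}"
    using level_nonempty[of "ht p" "tr p" "ht p"] assms(1) by (auto simp: S_star_def level_def)
  then have "v \<in> seqs_upto (ht q)"
    using assms(2,3) by (auto simp: S_le_def S_star_def normal_tree_def)
  with v show ?thesis
    by (auto simp: seqs_upto_def lessThan_eq_lessThan_iff)
qed

lemma seqs_upto_mono: "\<xi> \<le> \<eta> \<Longrightarrow> seqs_upto \<xi> \<subseteq> seqs_upto \<eta>"
  by (auto simp: seqs_upto_def intro: order_trans)

lemma new_guess:
  assumes "S_le q p" "z \<in> dom (gs q)" "z \<notin> dom (gs p)"
  shows "ht p < osup z"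
  using assms unfolding S_le_def by blast

lemma S_le_refl: "p \<in> S_star \<Longrightarrow> S_le p p"
  unfolding S_le_def S_star_def normal_tree_def closed_in_def by auto

context regular_uncountable
begin

text \<open>The clauses for the two given relations refer to different heights;
  \<open>ht p \<le> ht q\<close> lets the clauses relative to \<open>ht q\<close> be cut down to
  \<open>ht p\<close>.\<close>

lemma S_le_trans:
  fixes p q r :: "'a cond"
  assumes "p \<in> S_star" "q \<in> S_star" "r \<in> S_star" "S_le r q" "S_le q p"
  shows "S_le r p"
proof -
  have h: "ht p \<le> ht q"
    using S_le_ht assms by blast
  then have sub: "{..<osucc (ht p)} \<subseteq> {..<osucc (ht q)}"
    by auto
  have tr: "tr r \<inter> seqs_upto (ht p) = tr p"
    using assms(4,5) seqs_upto_mono[OF h] by (auto simp: S_le_def)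
  have lb: "lb p \<subseteq>\<^sub>m lb r"
    using assms(4,5) map_le_trans[of "lb p" "lb q" "lb r"] by (simp add: S_le_def)
  have dom_lb: "dom (lb r) \<inter> {..<osucc (ht p)} = dom (lb p)"
  proof -
    have "dom (lb r) \<inter> {..<osucc (ht q)} = dom (lb q)" "dom (lb q) \<inter> {..<osucc (ht p)} = dom (lb p)"
      using assms(4,5) by (simp_all add: S_le_def)
    moreover have "dom (lb r) \<inter> {..<osucc (ht p)} = dom (lb r) \<inter> {..<osucc (ht q)} \<inter> {..<osucc (ht p)}"
      using sub by (simp add: Int_assoc Int_absorb1)
    ultimately show ?thesis
      by simp
  qed
  have br: "the (br p v) \<subseteq>\<^sub>m the (br r v)" if "v \<in> tr p" for v
  proof (rule map_le_trans)
    have "tr p \<subseteq> tr q"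
      using assms(5) by (auto simp: S_le_def)
    then show "the (br p v) \<subseteq>\<^sub>m the (br q v)" "the (br q v) \<subseteq>\<^sub>m the (br r v)"
      using assms(4,5) that by (auto simp: S_le_def)
  qed
  have gs: "gs p \<subseteq>\<^sub>m gs r"
    using assms(4,5) map_le_trans[of "gs p" "gs q" "gs r"] by (simp add: S_le_def)
  have "ht p < osup z" if "z \<in> dom (gs r) - dom (gs p)" for z
    using new_guess[OF assms(4), of z] new_guess[OF assms(5), of z] that h by fastforce
  with tr lb dom_lb br gs show ?thesis
    by (simp add: S_le_def)
qed

end

lemma S_star_normal: "p \<in> S_star \<Longrightarrow> normal_tree (ht p) (tr p)"
  by (simp add: S_star_def)

lemma S_star_branch:
  assumes "p \<in> S_star" "v \<in> tr p"
  shows "the (br p v) \<in> tr p" "dom (the (br p v)) = {..<ht p}" "v \<subseteq>\<^sub>m the (br p v)"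
proof -
  have "v \<in> dom (br p)"
    using assms by (simp add: S_star_def)
  then obtain w where "br p v = Some w"
    by blast
  then show "the (br p v) \<in> tr p" "dom (the (br p v)) = {..<ht p}" "v \<subseteq>\<^sub>m the (br p v)"
    using assms(1) by (auto simp: S_star_def level_def)
qed

lemma S_star_guess_dom:
  assumes "p \<in> S_star" "z \<in> dom (gs p)"
  shows "z \<subseteq> {..<ht p}" "countable z"
  using assms by (auto simp: S_star_def Pctbl_def)

lemma S_star_label_dom: "p \<in> S_star \<Longrightarrow> dom (lb p) \<subseteq> {..<osucc (ht p)}"
  by (simp add: S_star_def closed_in_def)

lemma restrict_map_id: "dom v \<subseteq> X \<Longrightarrow> v |` X = v"
  by (rule ext) (metis domIff restrict_in restrict_out subsetD)

definition guess_sups :: "'a::wellorder cond set \<Rightarrow> 'a set" where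
  "guess_sups A = {osup z | z p. p \<in> A \<and> z \<in> dom (gs p) \<and> gs p z \<noteq> Some Dummy}"

text \<open>The amalgam of a chain of conditions puts one new level \<open>\<gamma>\<close>, a limit or a successor, on top of
  the union of the trees; the nodes on this level are the unions of the branches chosen by the
  functions \<open>b\<^sub>p\<close>, with zeros appended if \<open>\<gamma>\<close> is a successor.\<close>

locale condition_chain = regular_uncountable dummy for dummy :: "'a::wellorder itself" +
  fixes A :: "'a cond set" and \<gamma> :: 'a
  assumes nonempty: "A \<noteq> {}"
    and conds: "A \<subseteq> S_star"
    and chain: "p \<in> A \<Longrightarrow> q \<in> A \<Longrightarrow> S_le p q \<or> S_le q p"
    and ht_less: "p \<in> A \<Longrightarrow> ht p < \<gamma>"
    and ht_cofinal: "\<eta> < \<gamma> \<Longrightarrow> \<exists>p\<in>A. \<eta> \<le> ht p"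
begin

definition nodes :: "'a bin set" where
  "nodes = (\<Union>p\<in>A. tr p)"

definition branch :: "'a bin \<Rightarrow> 'a bin" where
  "branch v = (\<lambda>\<eta>. if \<eta> < \<gamma> then Some False else None) ++
     map_Sup {the (br p v) | p. p \<in> A \<and> v \<in> tr p}"

text \<open>The label at \<gamma> is a parameter, since its choice depends on the cofinality of
  \<gamma>. Nodes on the top level are their own chosen branches.\<close>

definition amalgam :: "'a bin set \<Rightarrow> 'a cond" where
  "amalgam L = \<lparr>ht = \<gamma>, tr = nodes \<union> branch ` nodes, lb = (map_Sup (lb ` A))(\<gamma> \<mapsto> L),
     br = (\<lambda>v. if v \<in> nodes then Some (branch v) else if v \<in> branch ` nodes then Some v else None),
     gs = map_Sup (gs ` A)\<rparr>"

lemma amalgam_sel [simp]: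
  "ht (amalgam L) = \<gamma>" "tr (amalgam L) = nodes \<union> branch ` nodes"
  "lb (amalgam L) = (map_Sup (lb ` A))(\<gamma> \<mapsto> L)" "gs (amalgam L) = map_Sup (gs ` A)"
  "br (amalgam L) = (\<lambda>v. if v \<in> nodes then Some (branch v)
     else if v \<in> branch ` nodes then Some v else None)"
  by (simp_all add: amalgam_def)

lemma in_S_star [simp]: "p \<in> A \<Longrightarrow> p \<in> S_star"
  using conds by blast

lemma directed:
  assumes "p \<in> A" "q \<in> A"
  shows "\<exists>r\<in>A. S_le r p \<and> S_le r q"
  using chain[OF assms] assms S_le_refl[OF in_S_star] by blast

lemma ex_higher:
  assumes "p \<in> A" "\<xi> < \<gamma>"
  shows "\<exists>r\<in>A. S_le r p \<and> \<xi> \<le> ht r"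
proof -
  obtain q where q: "q \<in> A" "\<xi> \<le> ht q"
    using ht_cofinal assms(2) by blast
  then obtain r where r: "r \<in> A" "S_le r p" "S_le r q"
    using directed assms(1) by blast
  then have "\<xi> \<le> ht r"
    using S_le_ht[of q r] q by auto
  with r show ?thesis
    by blast
qed

lemma S_le_tr_subset: "S_le q p \<Longrightarrow> tr p \<subseteq> tr q"
  by (auto simp: S_le_def)

lemma nodes_Int:
  assumes "p \<in> A"
  shows "nodes \<inter> seqs_upto (ht p) = tr p"
proof (rule subset_antisym)
  show "tr p \<subseteq> nodes \<inter> seqs_upto (ht p)"
    using assms S_star_normal[of p] by (auto simp: nodes_def normal_tree_def)
  show "nodes \<inter> seqs_upto (ht p) \<subseteq> tr p"
  proof
    fix v assume "v \<in> nodes \<inter> seqs_upto (ht p)"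
    then obtain q where q: "q \<in> A" "v \<in> tr q" "v \<in> seqs_upto (ht p)"
      by (auto simp: nodes_def)
    from chain[OF assms q(1)] show "v \<in> tr p"
      using q by (auto simp: S_le_def)
  qed
qed

lemma branches_eq_Some_iff:
  "map_Sup {the (br p v) | p. p \<in> A \<and> v \<in> tr p} \<eta> = Some y \<longleftrightarrow>
    (\<exists>p\<in>A. v \<in> tr p \<and> the (br p v) \<eta> = Some y)"
proof -
  have "m \<subseteq>\<^sub>m n \<or> n \<subseteq>\<^sub>m m"
    if mn: "m \<in> {the (br p v) | p. p \<in> A \<and> v \<in> tr p}" "n \<in> {the (br p v) | p. p \<in> A \<and> v \<in> tr p}" for m n
  proof -
    obtain p q where "p \<in> A" "q \<in> A" "v \<in> tr p" "v \<in> tr q" "m = the (br p v)" "n = the (br q v)"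
      using mn by blast
    with chain[of p q] show ?thesis
      by (auto simp: S_le_def)
  qed
  from map_Sup_eq_Some_iff[of "{the (br p v) | p. p \<in> A \<and> v \<in> tr p}", OF this] show ?thesis
    by auto
qed

lemma branch_extends:
  assumes "p \<in> A" "v \<in> tr p"
  shows "the (br p v) \<subseteq>\<^sub>m branch v"
proof -
  have "branch v \<eta> = Some y" if "the (br p v) \<eta> = Some y" for \<eta> y
  proof -
    have "map_Sup {the (br p v) | p. p \<in> A \<and> v \<in> tr p} \<eta> = Some y"
      using assms that by (auto simp: branches_eq_Some_iff)
    then show ?thesis
      by (simp add: branch_def)
  qed
  then show ?thesis
    unfolding map_le_def by (metis domD)
qed

lemma dom_branch: "dom (branch v) = {..<\<gamma>}"
proof -
  have "\<eta> < \<gamma>" if \<eta>: "map_Sup {the (br p v) | p. p \<in> A \<and> v \<in> tr p} \<eta> = Some y" for \<eta> y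
  proof -
    obtain p where p: "p \<in> A" "v \<in> tr p" "the (br p v) \<eta> = Some y"
      using \<eta> by (auto simp: branches_eq_Some_iff)
    then have "\<eta> < ht p"
      using S_star_branch(2)[of p v] by auto
    with ht_less[OF p(1)] show ?thesis
      by simp
  qed
  then show ?thesis
    unfolding branch_def by (auto split: if_splits)
qed

lemma branch_restrict:
  assumes "p \<in> A" "v \<in> tr p"
  shows "branch v |` {..<ht p} = the (br p v)"
proof (rule map_le_antisym)
  have dom: "dom (the (br p v)) = {..<ht p}"
    using S_star_branch(2)[of p v] assms by simp
  have agree: "the (br p v) \<eta> = branch v \<eta>" if "\<eta> < ht p" for \<eta>
    using branch_extends[OF assms] that dom by (auto simp: map_le_def)
  show "branch v |` {..<ht p} \<subseteq>\<^sub>m the (br p v)"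
    using agree by (auto simp: map_le_def restrict_map_def)
  show "the (br p v) \<subseteq>\<^sub>m branch v |` {..<ht p}"
    using agree dom by (auto simp: map_le_def restrict_map_def)
qed

text \<open>Some condition in the chain contains \<open>v\<close> and has height at least \<xi>; the
  segment is an initial segment of the branch that this condition chooses for
  \<open>v\<close>.\<close>

lemma branch_restrict_nodes:
  assumes "v \<in> nodes" "\<xi> < \<gamma>"
  shows "branch v |` {..<\<xi>} \<in> nodes"
proof -
  obtain p where p: "p \<in> A" "v \<in> tr p"
    using assms(1) by (auto simp: nodes_def)
  obtain r where r: "r \<in> A" "S_le r p" "\<xi> \<le> ht r"
    using ex_higher[OF p(1) assms(2)] by blast
  have v: "v \<in> tr r"
    using p r S_le_tr_subset by blast
  have "branch v |` {..<\<xi>} = the (br r v) |` {..<\<xi>}"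
    using r(3) unfolding branch_restrict[OF r(1) v, symmetric] restrict_restrict
    by (simp add: Int_absorb1)
  moreover have "the (br r v) |` {..<\<xi>} \<in> tr r"
    using S_star_branch(1)[of r v] S_star_normal[of r] r(1) v by (auto simp: normal_tree_def)
  ultimately show ?thesis
    using r(1) by (auto simp: nodes_def)
qed

lemma subset_branch:
  assumes "v \<in> nodes"
  shows "v \<subseteq>\<^sub>m branch v"
proof -
  obtain p where p: "p \<in> A" "v \<in> tr p"
    using assms by (auto simp: nodes_def)
  then show ?thesis
    using map_le_trans[OF S_star_branch(3)[of p v] branch_extends] by simp
qed

lemma dom_node:
  assumes "v \<in> nodes"
  shows "\<exists>\<xi><\<gamma>. dom v = {..<\<xi>}"
proof -
  obtain p where p: "p \<in> A" "v \<in> tr p"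
    using assms by (auto simp: nodes_def)
  then have "v \<in> seqs_upto (ht p)"
    using S_star_normal[of p] by (auto simp: normal_tree_def)
  with ht_less[OF p(1)] show ?thesis
    unfolding seqs_upto_def using le_less_trans by blast
qed

text \<open>Extensions to the level \<gamma> are the branches chosen through \<open>br\<close>.
  Extensions to a lower level already exist in a single condition that is high enough.\<close>

lemma amalgam_normal: "normal_tree \<gamma> (nodes \<union> branch ` nodes)"
proof -
  have "nodes \<union> branch ` nodes \<subseteq> seqs_upto \<gamma>"
    using dom_node by (force simp: seqs_upto_def dom_branch)
  moreover have "nodes \<noteq> {}"
  proof -
    obtain p where "p \<in> A"
      using nonempty by blast
    then show ?thesis
      using S_star_normal[of p] by (auto simp: nodes_def normal_tree_def)
  qed
  moreover have "v |` {..<\<xi>} \<in> nodes \<union> branch ` nodes" if v: "v \<in> nodes \<union> branch ` nodes" for v \<xi>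
  proof (cases "v \<in> nodes")
    case True
    then obtain p where p: "p \<in> A" "v \<in> tr p"
      by (auto simp: nodes_def)
    then have "v |` {..<\<xi>} \<in> tr p"
      using S_star_normal[of p] by (auto simp: normal_tree_def)
    with p(1) show ?thesis
      by (auto simp: nodes_def)
  next
    case False
    then obtain u where u: "u \<in> nodes" "v = branch u"
      using v by blast
    show ?thesis
    proof (cases "\<xi> < \<gamma>")
      case True
      then show ?thesis
        using branch_restrict_nodes u by simp
    next
      case False
      then have "v |` {..<\<xi>} = v"
        using dom_branch[of u] u(2) by (intro restrict_map_id) auto
      with v show ?thesis
        by simp
    qed
  qed
  moreover have "\<exists>w\<in>level (nodes \<union> branch ` nodes) \<xi>. v \<subseteq>\<^sub>m w"
    if v: "v \<in> nodes \<union> branch ` nodes" and \<xi>: "\<xi> \<le> \<gamma>" "dom v \<subseteq> {..<\<xi>}" for v \<xi>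
  proof (cases "v \<in> nodes")
    case True
    show ?thesis
    proof (cases "\<xi> = \<gamma>")
      case True
      then show ?thesis
        using \<open>v \<in> nodes\<close> by (intro bexI[of _ "branch v"]) (auto simp: level_def dom_branch subset_branch)
    next
      case False
      then have "\<xi> < \<gamma>"
        using \<xi>(1) by simp
      obtain p where p: "p \<in> A" "v \<in> tr p"
        using True by (auto simp: nodes_def)
      obtain r where r: "r \<in> A" "S_le r p" "\<xi> \<le> ht r"
        using ex_higher[OF p(1) \<open>\<xi> < \<gamma>\<close>] by blast
      have "v \<in> tr r"
        using p r S_le_tr_subset by blast
      then have "\<exists>w\<in>level (tr r) \<xi>. v \<subseteq>\<^sub>m w"
        using S_star_normal[of r] r \<xi>(2) by (simp add: normal_tree_def)
      with r(1) show ?thesis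
        by (auto simp: level_def nodes_def)
    qed
  next
    case False
    then obtain u where u: "u \<in> nodes" "v = branch u"
      using v by blast
    then have "\<xi> = \<gamma>"
      using \<xi> by (auto simp: dom_branch dest: lessThan_subset_iff[THEN iffD1])
    with u show ?thesis
      by (intro bexI[of _ v]) (auto simp: level_def dom_branch)
  qed
  ultimately show ?thesis
    unfolding normal_tree_def by blast
qed

text \<open>Labels and traces depend on a single level each, so this carries the clauses about them
  over from the members of the chain.\<close>

lemma level_amalgam:
  assumes "p \<in> A" "\<xi> \<le> ht p"
  shows "level (nodes \<union> branch ` nodes) \<xi> = level (tr p) \<xi>"
proof -
  have "v \<in> nodes \<longleftrightarrow> v \<in> tr p" if "dom v = {..<\<xi>}" for v
    using nodes_Int[OF assms(1)] assms(2) that by (auto simp: seqs_upto_def)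
  moreover have "dom (branch u) \<noteq> {..<\<xi>}" for u
    using ht_less[OF assms(1)] assms(2) by (auto simp: dom_branch lessThan_eq_lessThan_iff)
  ultimately show ?thesis
    by (auto simp: level_def)
qed

lemma labels_eq_Some_iff: "map_Sup (lb ` A) \<xi> = Some L \<longleftrightarrow> (\<exists>p\<in>A. lb p \<xi> = Some L)"
proof -
  have "m \<subseteq>\<^sub>m n \<or> n \<subseteq>\<^sub>m m" if "m \<in> lb ` A" "n \<in> lb ` A" for m n
    using that chain by (auto simp: S_le_def)
  from map_Sup_eq_Some_iff[of "lb ` A", OF this] show ?thesis
    by simp
qed

lemma guesses_eq_Some_iff: "map_Sup (gs ` A) z = Some g \<longleftrightarrow> (\<exists>p\<in>A. gs p z = Some g)"
proof -
  have "m \<subseteq>\<^sub>m n \<or> n \<subseteq>\<^sub>m m" if "m \<in> gs ` A" "n \<in> gs ` A" for m n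
    using that chain by (auto simp: S_le_def)
  from map_Sup_eq_Some_iff[of "gs ` A", OF this] show ?thesis
    by simp
qed

lemma dom_labels: "dom (map_Sup (lb ` A)) = (\<Union>p\<in>A. dom (lb p))"
  by (auto simp: dom_def labels_eq_Some_iff)

lemma dom_guesses: "dom (map_Sup (gs ` A)) = (\<Union>p\<in>A. dom (gs p))"
  by (auto simp: dom_def guesses_eq_Some_iff)

lemma dom_labels_Int:
  assumes "p \<in> A"
  shows "dom (map_Sup (lb ` A)) \<inter> {..<osucc (ht p)} = dom (lb p)"
proof (rule subset_antisym)
  show "dom (lb p) \<subseteq> dom (map_Sup (lb ` A)) \<inter> {..<osucc (ht p)}"
    using assms S_star_label_dom[of p] by (auto simp: dom_labels)
  show "dom (map_Sup (lb ` A)) \<inter> {..<osucc (ht p)} \<subseteq> dom (lb p)"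
  proof
    fix \<xi> assume "\<xi> \<in> dom (map_Sup (lb ` A)) \<inter> {..<osucc (ht p)}"
    then obtain q where q: "q \<in> A" "\<xi> \<in> dom (lb q)" "\<xi> \<in> {..<osucc (ht p)}"
      unfolding dom_labels by blast
    from chain[OF assms q(1)] show "\<xi> \<in> dom (lb p)"
    proof
      assume "S_le p q"
      then have "lb q \<subseteq>\<^sub>m lb p"
        by (simp add: S_le_def)
      with q(2) show ?thesis
        using map_le_implies_dom_le by blast
    next
      assume "S_le q p"
      then have "dom (lb q) \<inter> {..<osucc (ht p)} = dom (lb p)"
        by (simp add: S_le_def)
      with q(2,3) show ?thesis
        by blast
    qed
  qed
qed

lemma amalgam_le:
  assumes "p \<in> A"
  shows "S_le (amalgam L) p"
proof -
  have "branch u \<notin> seqs_upto (ht p)" for u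
    using ht_less[OF assms] by (auto simp: seqs_upto_def dom_branch lessThan_eq_lessThan_iff)
  then have "(nodes \<union> branch ` nodes) \<inter> seqs_upto (ht p) = tr p"
    using nodes_Int[OF assms] by blast
  moreover have "\<gamma> \<notin> dom (lb p)"
    using S_star_label_dom[of p] ht_less[OF assms] assms by force
  then have "lb p \<subseteq>\<^sub>m (map_Sup (lb ` A))(\<gamma> \<mapsto> L)"
    using assms unfolding map_le_def by (auto simp: labels_eq_Some_iff intro!: sym[of "map_Sup (lb ` A) _"])
  moreover have "dom ((map_Sup (lb ` A))(\<gamma> \<mapsto> L)) \<inter> {..<osucc (ht p)} = dom (lb p)"
    using dom_labels_Int[OF assms] ht_less[OF assms] by auto
  moreover have "the (br p v) \<subseteq>\<^sub>m the (br (amalgam L) v)" if "v \<in> tr p" for v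
  proof -
    have "v \<in> nodes"
      using that assms by (auto simp: nodes_def)
    then show ?thesis
      using branch_extends[OF assms that] by simp
  qed
  moreover have "gs p \<subseteq>\<^sub>m map_Sup (gs ` A)"
    using assms unfolding map_le_def by (auto simp: guesses_eq_Some_iff intro!: sym[of "map_Sup (gs ` A) _"])
  moreover have "ht p < osup z" if z: "z \<in> dom (map_Sup (gs ` A)) - dom (gs p)" for z
  proof -
    obtain q where q: "q \<in> A" "z \<in> dom (gs q)"
      using z by (auto simp: dom_guesses)
    have "\<not> S_le p q"
      using z q map_le_implies_dom_le[of "gs q" "gs p"] unfolding S_le_def by blast
    then have "S_le q p"
      using chain[OF assms q(1)] by blast
    then show ?thesis
      using new_guess q z by blast
  qed
  ultimately show ?thesis
    unfolding S_le_def by simp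
qed

end

section \<open>Clubs, guessed sets and the label at the new height\<close>

lemma old_guess: "S_le q p \<Longrightarrow> z \<in> dom (gs p) \<Longrightarrow> gs q z = gs p z"
  by (simp add: S_le_def map_le_def)

lemma old_label: "S_le q p \<Longrightarrow> \<xi> \<in> dom (lb p) \<Longrightarrow> lb q \<xi> = lb p \<xi>"
  by (simp add: S_le_def map_le_def)

lemma stationary_in_mono: "stationary_in S \<beta> \<Longrightarrow> S \<subseteq> S' \<Longrightarrow> stationary_in S' \<beta>"
  unfolding stationary_in_def by blast

lemma label_ok_cong: "level t \<xi> = level t' \<xi> \<Longrightarrow> label_ok t \<xi> L \<longleftrightarrow> label_ok t' \<xi> L"
  by (simp add: label_ok_def)

context regular_uncountable
begin

text \<open>The tail \<open>{\<gamma>..<\<beta>}\<close> is a club missing \<open>S\<close>.\<close>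

lemma bounded_not_stationary:
  assumes "S \<subseteq> {..<\<gamma>}" "\<gamma> < (\<beta>::'a)"
  shows "\<not> stationary_in S \<beta>"
proof -
  have "club_in {\<gamma>..<\<beta>} \<beta>"
    unfolding club_in_def closed_in_def limit_point_def
  proof (intro conjI allI impI)
    fix \<delta> assume \<delta>: "\<delta> < \<beta>" "(\<exists>\<eta>. \<eta> < \<delta>) \<and> (\<forall>\<eta><\<delta>. \<exists>\<xi>\<in>{\<gamma>..<\<beta>}. \<eta> < \<xi> \<and> \<xi> < \<delta>)"
    then obtain \<xi> where "\<xi> \<in> {\<gamma>..<\<beta>}" "\<xi> < \<delta>"
      by blast
    with \<delta>(1) show "\<delta> \<in> {\<gamma>..<\<beta>}"
      by auto
  next
    fix \<eta> assume "\<eta> < \<beta>"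
    with assms(2) show "\<exists>\<xi>\<in>{\<gamma>..<\<beta>}. \<eta> \<le> \<xi>"
      by (intro bexI[of _ "max \<eta> \<gamma>"]) auto
  qed auto
  with assms(1) show ?thesis
    unfolding stationary_in_def by (intro notI) force
qed

text \<open>An enumeration of a countable cofinal set would show that the cofinality is at most
  \<open>omega\<close>. The point \<beta> serves as the bound when \<open>x\<close> is
  empty.\<close>

lemma countable_bounded_below_cf:
  assumes "omega < cf (\<gamma>::'a)" "\<beta> < \<gamma>" "countable x" "x \<subseteq> {..<\<gamma>}"
  shows "\<exists>b<\<gamma>. \<forall>\<xi>\<in>x. \<xi> \<le> b"
proof (rule ccontr)
  assume neg: "\<not> (\<exists>b<\<gamma>. \<forall>\<xi>\<in>x. \<xi> \<le> b)"
  then have "x \<noteq> {}"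
    using assms(2) by blast
  then have range: "range (from_nat_into x) = x"
    using assms(3) by (rule range_from_nat_into)
  have "\<exists>n. \<eta> \<le> from_nat_into x n" if "\<eta> < \<gamma>" for \<eta>
  proof -
    obtain \<xi> where "\<xi> \<in> x" "\<eta> \<le> \<xi>"
      using neg \<open>\<eta> < \<gamma>\<close> by (meson linear)
    with range show ?thesis
      by (metis imageE)
  qed
  moreover have "from_nat_into x n < \<gamma>" for n
    using from_nat_into[OF \<open>x \<noteq> {}\<close>] assms(4) by blast
  ultimately have "cf \<gamma> \<le> omega"
    using cf_le_omega by blast
  with assms(1) show False
    by simp
qed

text \<open>Turns a club of ordinals into a club of countable sets, as labels require. For
  unboundedness, a point of \<open>C\<close> above all of \<open>x\<close> is adjoined and becomes
  the supremum. For closure, the supremum of the union is attained by one of the sets or is a limit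
  point of \<open>C\<close>.\<close>

lemma club_Pctbl_osup:
  assumes "omega < cf (\<gamma>::'a)" "\<beta> < \<gamma>" "club_in C \<gamma>"
  shows "club_Pctbl {z \<in> Pctbl {..<\<gamma>}. osup z \<in> C} {..<\<gamma>}"
  unfolding club_Pctbl_def
proof (intro conjI ballI allI impI)
  fix x assume x: "x \<in> Pctbl {..<\<gamma>}"
  then obtain b where b: "b < \<gamma>" "\<forall>\<xi>\<in>x. \<xi> \<le> b"
    using countable_bounded_below_cf[OF assms(1,2), of x] unfolding Pctbl_def by blast
  obtain c where c: "c \<in> C" "b \<le> c"
    using assms(3) b(1) by (auto simp: club_in_def)
  have "c < \<gamma>"
    using assms(3) c(1) by (auto simp: club_in_def closed_in_def)
  have le: "\<xi> \<le> c" if "\<xi> \<in> insert c x" for \<xi>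
    using that b(2) c(2) by auto
  have "osup (insert c x) = c"
    by (rule antisym[OF osup_le le_osup]) (use le in auto)
  with x c(1) \<open>c < \<gamma>\<close> have "insert c x \<in> {z \<in> Pctbl {..<\<gamma>}. osup z \<in> C}"
    by (simp add: Pctbl_def)
  then show "\<exists>y\<in>{z \<in> Pctbl {..<\<gamma>}. osup z \<in> C}. x \<subseteq> y"
    by blast
next
  fix \<delta> :: 'a and s
  assume s: "{..<\<delta>} \<noteq> {} \<and> countable {..<\<delta>} \<and> (\<forall>i<\<delta>. s i \<in> {z \<in> Pctbl {..<\<gamma>}. osup z \<in> C}) \<and>
    (\<forall>i j. i \<le> j \<and> j < \<delta> \<longrightarrow> s i \<subseteq> s j)"
  let ?U = "\<Union>i\<in>{..<\<delta>}. s i"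
  have "?U \<subseteq> {..<\<gamma>}"
    using s by (auto simp: Pctbl_def)
  moreover have "countable ?U"
    using s by (intro countable_UN) (auto simp: Pctbl_def)
  ultimately have U: "?U \<in> Pctbl {..<\<gamma>}"
    by (simp add: Pctbl_def)
  then obtain b where b: "b < \<gamma>" "\<forall>\<xi>\<in>?U. \<xi> \<le> b"
    using countable_bounded_below_cf[OF assms(1,2), of ?U] unfolding Pctbl_def by blast
  have U_le: "\<xi> \<le> osup ?U" if "\<xi> \<in> ?U" for \<xi>
    by (rule le_osup[OF _ that]) (use b(2) in blast)
  have "osup ?U \<le> b"
    by (rule osup_le) (use b(2) in blast)
  then have less: "osup ?U < \<gamma>"
    using b(1) by simp
  have s_le: "osup (s i) \<le> osup ?U" if "i < \<delta>" for i
    by (rule osup_le) (use U_le that in blast)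
  have le_s: "\<xi> \<le> osup (s i)" if "\<xi> \<in> s i" "i < \<delta>" for i \<xi>
    by (rule le_osup[OF _ that(1)]) (use b(2) that(2) in blast)
  have "osup ?U \<in> C"
  proof (cases "\<exists>i<\<delta>. osup (s i) = osup ?U")
    case True
    then show ?thesis
      using s by force
  next
    case False
    then have s_less: "osup (s i) < osup ?U" if "i < \<delta>" for i
      using s_le that by (metis le_neq_trans)
    have "limit_point C (osup ?U)"
      unfolding limit_point_def
    proof (intro conjI allI impI)
      show "\<exists>\<eta>. \<eta> < osup ?U"
      proof -
        obtain i where "i < \<delta>"
          using s by auto
        then show ?thesis
          using s_less by blast
      qed
      fix \<eta> assume "\<eta> < osup ?U"
      then obtain \<xi> where "\<xi> \<in> ?U" "\<eta> < \<xi>"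
        using osup_le[of ?U \<eta>] by (meson not_le)
      then obtain i where "i < \<delta>" "\<xi> \<in> s i"
        by blast
      then have "osup (s i) \<in> C" "\<eta> < osup (s i)" "osup (s i) < osup ?U"
        using s s_less[of i] le_s[of \<xi> i] \<open>\<eta> < \<xi>\<close> by auto
      then show "\<exists>\<xi>\<in>C. \<eta> < \<xi> \<and> \<xi> < osup ?U"
        by blast
    qed
    with assms(3) less show ?thesis
      unfolding club_in_def closed_in_def by blast
  qed
  with U show "?U \<in> {z \<in> Pctbl {..<\<gamma>}. osup z \<in> C}"
    by simp
qed auto

lemma guess_osup_le: "p \<in> S_star \<Longrightarrow> z \<in> dom (gs p) \<Longrightarrow> osup z \<le> ht (p :: 'a cond)"
  using S_star_guess_dom(1)[of p z] by (intro osup_le) auto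

lemma guess_hat_le: "p \<in> S_star \<Longrightarrow> z \<in> dom (gs p) \<Longrightarrow> hat z \<le> ht (p :: 'a cond)"
  using S_star_guess_dom(1)[of p z] by (intro hat_le) auto

text \<open>A guess is the restriction to \<open>z\<close> of a node whose domain
  \<open>{..<hat z}\<close> includes \<open>z\<close>. Hence a guess determines the set at which it
  was made.\<close>

lemma guess_dom:
  assumes "p \<in> S_star" "gs (p :: 'a cond) z = Some (Bin v)"
  shows "dom v = z"
proof -
  have z: "z \<in> dom (gs p)"
    using assms(2) by blast
  have "Bin v \<in> Bin ` trace (tr p) z \<union> {Dummy}"
    using assms unfolding S_star_def by blast
  then obtain r where r: "r \<in> level (tr p) (hat z)" "v = r |` z"
    by (auto simp: trace_def)
  have "\<xi> < hat z" if "\<xi> \<in> z" for \<xi>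
    by (rule less_hat[OF _ that]) (use S_star_guess_dom(1)[OF assms(1) z] in auto)
  with r show ?thesis
    by (auto simp: level_def)
qed

end

context condition_chain
begin

lemma guess_sups_subset: "guess_sups A \<subseteq> {..<\<gamma>}"
proof
  fix \<delta> assume "\<delta> \<in> guess_sups A"
  then obtain p z where "p \<in> A" "z \<in> dom (gs p)" "\<delta> = osup z"
    by (auto simp: guess_sups_def)
  then show "\<delta> \<in> {..<\<gamma>}"
    using guess_osup_le[of p z] ht_less[of p] by auto
qed

text \<open>Guesses added after \<open>p\<close> have suprema above \<open>ht p\<close>, so any
  guess with a smaller supremum was already made by \<open>p\<close>.\<close>

lemma guess_sups_below:
  assumes "p \<in> A"
  shows "guess_sups A \<inter> {..ht p} \<subseteq> {osup z | z. z \<in> dom (gs p) \<and> gs p z \<noteq> Some Dummy}"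
proof
  fix \<delta> assume "\<delta> \<in> guess_sups A \<inter> {..ht p}"
  then obtain q z where q: "q \<in> A" "z \<in> dom (gs q)" "gs q z \<noteq> Some Dummy" "\<delta> = osup z" "\<delta> \<le> ht p"
    by (auto simp: guess_sups_def)
  have "z \<in> dom (gs p)"
    using chain[OF assms q(1)]
  proof
    assume "S_le p q"
    then show ?thesis
      using q(2) old_guess by (metis domIff)
  next
    assume "S_le q p"
    then show ?thesis
      using new_guess[of q p z] q by force
  qed
  moreover have "gs p z = gs q z"
    using chain[OF assms q(1)] old_guess q(2) \<open>z \<in> dom (gs p)\<close> by metis
  ultimately show "\<delta> \<in> {osup z | z. z \<in> dom (gs p) \<and> gs p z \<noteq> Some Dummy}"
    using q by auto
qed

text \<open>Below \<gamma> the claim is inherited from one condition that is high enough, and above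
  \<gamma> the set is bounded; only \<gamma> itself needs the hypothesis.\<close>

lemma guess_sups_nowhere_stationary:
  assumes "omega < cf \<gamma> \<Longrightarrow> \<not> stationary_in (guess_sups A) \<gamma>"
  shows "nowhere_stationary (guess_sups A)"
  unfolding nowhere_stationary_def
proof (intro allI impI)
  fix \<beta> :: 'a assume \<beta>: "omega < cf \<beta>"
  consider "\<beta> < \<gamma>" | "\<beta> = \<gamma>" | "\<gamma> < \<beta>"
    by force
  then show "\<not> stationary_in (guess_sups A \<inter> {..<\<beta>}) \<beta>"
  proof cases
    case 1
    then obtain p where p: "p \<in> A" "\<beta> \<le> ht p"
      using ht_cofinal by blast
    let ?S = "{osup z | z. z \<in> dom (gs p) \<and> gs p z \<noteq> Some Dummy}"
    have "nowhere_stationary ?S"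
      using in_S_star[OF p(1)] by (simp add: S_star_def)
    then have "\<not> stationary_in (?S \<inter> {..<\<beta>}) \<beta>"
      using \<beta> unfolding nowhere_stationary_def by blast
    moreover have "{..<\<beta>} \<subseteq> {..ht p}"
      using p(2) by auto
    then have "guess_sups A \<inter> {..<\<beta>} \<subseteq> ?S \<inter> {..<\<beta>}"
      using guess_sups_below[OF p(1)] by blast
    ultimately show ?thesis
      using stationary_in_mono by blast
  next
    case 2
    then show ?thesis
      using assms \<beta> stationary_in_mono[of _ \<gamma> "guess_sups A"] by blast
  next
    case 3
    show ?thesis
      by (rule bounded_not_stationary[OF _ 3]) (use guess_sups_subset in blast)
  qed
qed

text \<open>Below \<gamma> closedness is local: all labels up to \<delta> belong to any member of
  height at least \<delta>. The point \<gamma> is labelled by construction.\<close>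

lemma labels_closed: "closed_in (dom ((map_Sup (lb ` A))(\<gamma> \<mapsto> L))) (osucc \<gamma>)"
  unfolding closed_in_def
proof (intro conjI allI impI)
  have dom_less: "\<xi> < \<gamma>" if \<xi>: "\<xi> \<in> dom (map_Sup (lb ` A))" for \<xi>
  proof -
    obtain p where p: "p \<in> A" "\<xi> \<in> dom (lb p)"
      using \<xi> by (auto simp: dom_labels)
    then have "\<xi> \<le> ht p"
      using S_star_label_dom[of p] by force
    with ht_less[OF p(1)] show ?thesis
      by simp
  qed
  have "dom (map_Sup (lb ` A)) \<subseteq> {..<osucc \<gamma>}"
    using dom_less less_imp_le by (metis less_osucc lessThan_iff subsetI)
  then show "dom ((map_Sup (lb ` A))(\<gamma> \<mapsto> L)) \<subseteq> {..<osucc \<gamma>}"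
    by simp
  fix \<delta> assume \<delta>: "\<delta> < osucc \<gamma>" "limit_point (dom ((map_Sup (lb ` A))(\<gamma> \<mapsto> L))) \<delta>"
  show "\<delta> \<in> dom ((map_Sup (lb ` A))(\<gamma> \<mapsto> L))"
  proof (cases "\<delta> = \<gamma>")
    case False
    then have "\<delta> < \<gamma>"
      using \<delta>(1) by simp
    then obtain p where p: "p \<in> A" "\<delta> \<le> ht p"
      using ht_cofinal by blast
    have mem: "\<xi> \<in> dom (lb p)" if "\<xi> \<in> dom ((map_Sup (lb ` A))(\<gamma> \<mapsto> L))" "\<xi> < \<delta>" for \<xi>
      using that p(2) \<open>\<delta> < \<gamma>\<close> unfolding dom_labels_Int[OF p(1), symmetric] by auto
    have "limit_point (dom (lb p)) \<delta>"
      using \<delta>(2) mem unfolding limit_point_def by meson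
    then have "\<delta> \<in> dom (lb p)"
      using in_S_star[OF p(1)] p(2) by (simp add: S_star_def closed_in_def)
    with p(1) have "\<delta> \<in> dom (map_Sup (lb ` A))"
      by (auto simp: dom_labels)
    then show ?thesis
      by auto
  qed simp
qed

text \<open>The hypotheses are exactly what is new at \<gamma>. Every other requirement involves at
  most two members of the chain and is checked in a common stronger one.\<close>

lemma amalgam_in_S_star:
  assumes nonstat: "omega < cf \<gamma> \<Longrightarrow> \<not> stationary_in (guess_sups A) \<gamma>"
    and label: "label_ok (nodes \<union> branch ` nodes) \<gamma> L"
    and disjoint: "\<And>p z v. p \<in> A \<Longrightarrow> gs p z = Some (Bin v) \<Longrightarrow> v \<notin> L"
  shows "amalgam L \<in> S_star"
proof -
  let ?G = "map_Sup (gs ` A)"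
  let ?T = "nodes \<union> branch ` nodes"
  have lab: "label_ok ?T \<xi> M" if \<xi>: "((map_Sup (lb ` A))(\<gamma> \<mapsto> L)) \<xi> = Some M" for \<xi> M
  proof (cases "\<xi> = \<gamma>")
    case True
    with \<xi> label show ?thesis
      by simp
  next
    case False
    then obtain p where p: "p \<in> A" "lb p \<xi> = Some M"
      using \<xi> by (auto simp: labels_eq_Some_iff)
    then have "\<xi> \<in> {..<osucc (ht p)}" "label_ok (tr p) \<xi> M"
      using S_star_label_dom[of p] in_S_star[OF p(1)] by (auto simp: S_star_def)
    then show ?thesis
      using label_ok_cong[OF level_amalgam[OF p(1)]] by simp
  qed
  have "dom (br (amalgam L)) = ?T"
    by (auto split: if_splits)
  moreover have "w \<in> level ?T \<gamma> \<and> v \<subseteq>\<^sub>m w" if "br (amalgam L) v = Some w" for v w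
  proof -
    have "w \<in> branch ` nodes" "v \<subseteq>\<^sub>m w"
      using that subset_branch by (auto split: if_splits)
    moreover from this have "dom w = {..<\<gamma>}"
      using dom_branch by blast
    ultimately show ?thesis
      by (simp add: level_def)
  qed
  moreover have "dom ?G \<subseteq> Pctbl {..<\<gamma>}"
  proof
    fix z assume "z \<in> dom ?G"
    then obtain p where "p \<in> A" "z \<in> dom (gs p)"
      by (auto simp: dom_guesses)
    then show "z \<in> Pctbl {..<\<gamma>}"
      using S_star_guess_dom[of p z] ht_less[of p] by (auto simp: Pctbl_def)
  qed
  moreover have "g \<in> Bin ` trace ?T z \<union> {Dummy}" if g: "?G z = Some g" for z g
  proof -
    obtain p where p: "p \<in> A" "gs p z = Some g"
      using g by (auto simp: guesses_eq_Some_iff)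
    then have "g \<in> Bin ` trace (tr p) z \<union> {Dummy}"
      using in_S_star[OF p(1)] unfolding S_star_def by blast
    moreover have "trace ?T z = trace (tr p) z"
      using level_amalgam[OF p(1)] guess_hat_le[of p z] p by (auto simp: trace_def)
    ultimately show ?thesis
      by simp
  qed
  moreover have "inj_on osup (dom ?G)"
  proof (rule inj_onI)
    fix z z' assume z: "z \<in> dom ?G" "z' \<in> dom ?G" "osup z = osup z'"
    then obtain p p' where p: "p \<in> A" "z \<in> dom (gs p)" "p' \<in> A" "z' \<in> dom (gs p')"
      by (auto simp: dom_guesses)
    obtain r where r: "r \<in> A" "S_le r p" "S_le r p'"
      using directed p by blast
    then have "z \<in> dom (gs r)" "z' \<in> dom (gs r)"
      using p old_guess by (metis domIff)+
    moreover have "inj_on osup (dom (gs r))"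
      using in_S_star[OF r(1)] by (simp add: S_star_def)
    ultimately show "z = z'"
      using z(3) by (simp add: inj_on_def)
  qed
  moreover have "{osup z | z. z \<in> dom ?G \<and> ?G z \<noteq> Some Dummy} = guess_sups A"
  proof -
    have G: "?G z = gs p z" if "p \<in> A" "z \<in> dom (gs p)" for p z
      using that by (auto simp: guesses_eq_Some_iff)
    have "z \<in> dom ?G \<and> ?G z \<noteq> Some Dummy \<longleftrightarrow> (\<exists>p\<in>A. z \<in> dom (gs p) \<and> gs p z \<noteq> Some Dummy)" for z
      unfolding dom_guesses UN_iff using G by metis
    then show ?thesis
      unfolding guess_sups_def by auto
  qed
  then have "nowhere_stationary {osup z | z. z \<in> dom ?G \<and> ?G z \<noteq> Some Dummy}"
    using guess_sups_nowhere_stationary nonstat by simp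
  moreover have "ran ?G \<inter> Bin ` M = {}" if \<xi>: "((map_Sup (lb ` A))(\<gamma> \<mapsto> L)) \<xi> = Some M" for \<xi> M
  proof -
    have "v \<notin> M" if v: "?G z = Some (Bin v)" for z v
    proof -
      obtain p where p: "p \<in> A" "gs p z = Some (Bin v)"
        using v by (auto simp: guesses_eq_Some_iff)
      show ?thesis
      proof (cases "\<xi> = \<gamma>")
        case True
        with \<xi> disjoint p show ?thesis
          by auto
      next
        case False
        then obtain q where q: "q \<in> A" "lb q \<xi> = Some M"
          using \<xi> by (auto simp: labels_eq_Some_iff)
        \<comment> \<open>An old label and a guess may come from different members; clause (5) is
          applied in a member below both.\<close>
        obtain r where r: "r \<in> A" "S_le r p" "S_le r q"
          using directed p(1) q(1) by blast
        have "gs r z = Some (Bin v)"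
          using old_guess[OF r(2), of z] p(2) by auto
        moreover have "lb r \<xi> = Some M"
          using old_label[OF r(3), of \<xi>] q(2) by auto
        then have "ran (gs r) \<inter> Bin ` M = {}"
          using in_S_star[OF r(1)] by (simp add: S_star_def)
        ultimately show ?thesis
          by (auto intro: ranI)
      qed
    qed
    then show ?thesis
      by (auto simp: ran_def)
  qed
  ultimately show ?thesis
    using amalgam_normal labels_closed lab unfolding S_star_def by simp
qed

text \<open>If \<open>\<gamma>\<close> has uncountable cofinality, a club of \<open>\<gamma>\<close> avoiding the suprema of the guessed sets
  yields a club of countable sets on which only dummy guesses are made, and so a label disjoint from
  all guesses.\<close>

lemma lower_bound:
  assumes nonstat: "omega < cf \<gamma> \<Longrightarrow> \<not> stationary_in (guess_sups A) \<gamma>"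
  shows "\<exists>q\<in>S_star. ht q = \<gamma> \<and> (\<forall>p\<in>A. S_le q p) \<and> (\<forall>z\<in>dom (gs q). osup z < \<gamma>)"
proof -
  have "\<exists>L. label_ok (nodes \<union> branch ` nodes) \<gamma> L \<and> (\<forall>p\<in>A. \<forall>z v. gs p z = Some (Bin v) \<longrightarrow> v \<notin> L)"
  proof (cases "omega < cf \<gamma>")
    case False
    then show ?thesis
      by (intro exI[of _ "{}"]) (simp add: label_ok_def)
  next
    case True
    then obtain C where C: "club_in C \<gamma>" "guess_sups A \<inter> C = {}"
      using nonstat unfolding stationary_in_def by blast
    obtain p where p: "p \<in> A"
      using nonempty by blast
    \<comment> \<open>Any node on the new level will do, since disjointness from the guesses depends
      only on domains.\<close>
    obtain x where x: "x \<in> level (nodes \<union> branch ` nodes) \<gamma>"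
      using level_nonempty[OF amalgam_normal] by blast
    let ?E = "{z \<in> Pctbl {..<\<gamma>}. osup z \<in> C}"
    let ?L = "{x} \<union> {x |` z | z. z \<in> ?E}"
    have "label_ok (nodes \<union> branch ` nodes) \<gamma> ?L"
      using True x club_Pctbl_osup[OF True ht_less[OF p] C(1)] unfolding label_ok_def by auto
    moreover have "v \<notin> ?L" if q: "q \<in> A" "gs q z = Some (Bin v)" for q z v
    proof
      have z: "dom v = z"
        using guess_dom q in_S_star by blast
      have dom_x: "dom x = {..<\<gamma>}"
        using x by (simp add: level_def)
      assume "v \<in> ?L"
      then consider "v = x" | y where "v = x |` y" "y \<in> ?E"
        by blast
      then show False
      proof cases
        \<comment> \<open>The domain of \<open>x\<close> is all of \<open>{..<\<gamma>}\<close>,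
          whereas a guessed set lies below the height of some condition.\<close>
        case 1
        then have "{..<\<gamma>} \<subseteq> {..<ht q}"
          using S_star_guess_dom(1)[of q z] q z dom_x by auto
        then show False
          using ht_less[OF q(1)] by auto
      next
        \<comment> \<open>Equal functions have equal domains, so \<open>y\<close> is the guessed set
          itself, and its supremum would lie in \<open>C\<close>.\<close>
        case 2
        then have "y = z"
          using z dom_x by (auto simp: Pctbl_def)
        then have "osup z \<in> C"
          using 2 by simp
        moreover have "osup z \<in> guess_sups A"
          using q unfolding guess_sups_def by fastforce
        ultimately show False
          using C(2) by blast
      qed
    qed
    ultimately show ?thesis
      by blast
  qed
  then obtain L where L: "label_ok (nodes \<union> branch ` nodes) \<gamma> L"
    "\<And>p z v. p \<in> A \<Longrightarrow> gs p z = Some (Bin v) \<Longrightarrow> v \<notin> L"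
    by blast
  have "amalgam L \<in> S_star"
    using nonstat L by (rule amalgam_in_S_star)
  moreover have "osup z < \<gamma>" if z: "z \<in> dom (gs (amalgam L))" for z
  proof -
    obtain p where "p \<in> A" "z \<in> dom (gs p)"
      using z by (auto simp: dom_guesses)
    then show ?thesis
      using guess_osup_le[of p z] ht_less[of p] by simp
  qed
  ultimately show ?thesis
    using amalgam_le by (intro bexI[of _ "amalgam L"]) auto
qed

end

section \<open>Tight lower bounds and \<sigma>-closure\<close>

text \<open>The last clause keeps \<open>ht q\<close> from being the supremum of a set already
  guessed; the order then keeps it from becoming one later.\<close>

definition tight_bound :: "'a::wellorder cond set \<Rightarrow> 'a cond \<Rightarrow> bool" where
  "tight_bound A q \<longleftrightarrow> q \<in> S_star \<and> ht q = hat (ht ` A) \<and> (\<forall>p\<in>A. S_le q p) \<and>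
     (\<forall>z\<in>dom (gs q). osup z < ht q)"

lemma ht_tight_bound_notin_guess_sups:
  assumes "tight_bound B r" "\<And>p. p \<in> A \<Longrightarrow> S_le p r \<or> S_le r p"
  shows "ht r \<notin> guess_sups A"
proof
  assume "ht r \<in> guess_sups A"
  then obtain p z where p: "p \<in> A" "z \<in> dom (gs p)" "ht r = osup z"
    by (auto simp: guess_sups_def)
  have "z \<in> dom (gs r)"
    using assms(2)[OF p(1)]
  proof
    assume "S_le p r"
    then show ?thesis
      using new_guess[of p r z] p by force
  next
    assume "S_le r p"
    then show ?thesis
      using old_guess[of r p z] p by (simp add: dom_def)
  qed
  then have "osup z < ht r"
    using assms(1) unfolding tight_bound_def by blast
  with p(3) show False
    by simp
qed

context regular_uncountable
begin

lemma ex_tight_bound: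
  fixes A :: "'a cond set"
  assumes "A \<noteq> {}" "A \<subseteq> S_star" "\<And>p q. p \<in> A \<Longrightarrow> q \<in> A \<Longrightarrow> S_le p q \<or> S_le q p"
    and bounded: "\<And>p. p \<in> A \<Longrightarrow> ht p < b"
    and nonstat: "omega < cf (hat (ht ` A)) \<Longrightarrow> \<not> stationary_in (guess_sups A) (hat (ht ` A))"
  shows "\<exists>q. tight_bound A q"
proof -
  interpret condition_chain dummy A "hat (ht ` A)"
  proof
    show "ht p < hat (ht ` A)" if "p \<in> A" for p
      by (rule less_hat[of _ b]) (use bounded that in auto)
    show "\<exists>p\<in>A. \<eta> \<le> ht p" if "\<eta> < hat (ht ` A)" for \<eta>
      using less_hatD[OF that] by auto
  qed (use assms in auto)
  show ?thesis
    using lower_bound[OF nonstat] unfolding tight_bound_def by metis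
qed

lemma sigma_closed_S_star: "sigma_closed (S_star :: 'a cond set) S_le"
  unfolding sigma_closed_def
proof (intro allI impI)
  fix s :: "nat \<Rightarrow> 'a cond"
  assume "(\<forall>n. s n \<in> S_star) \<and> (\<forall>n. S_le (s (Suc n)) (s n))"
  then have s: "s n \<in> S_star" "S_le (s (Suc n)) (s n)" for n
    by auto
  have decreasing: "S_le (s m) (s n)" if "n \<le> m" for m n
    using that
  proof (induction m rule: dec_induct)
    case base
    show ?case
      using S_le_refl s(1) by blast
  next
    case (step m)
    then show ?case
      using S_le_trans s by blast
  qed
  obtain b where b: "\<forall>\<xi>\<in>range (\<lambda>n. ht (s n)). \<xi> < b"
    using countable_bounded[of "range (\<lambda>n. ht (s n))"] by auto
  have "\<exists>q. tight_bound (range s) q"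
  proof (rule ex_tight_bound)
    show "S_le p q \<or> S_le q p" if pq: "p \<in> range s" "q \<in> range s" for p q
    proof -
      obtain m n where "p = s m" "q = s n"
        using pq by blast
      then show ?thesis
        using decreasing by (meson linear)
    qed
    show "ht p < b" if "p \<in> range s" for p
      using b that by auto
    \<comment> \<open>The sequence of heights is itself a countable cofinal sequence, also when it
      is eventually constant and the strict supremum is a successor.\<close>
    have "cf (hat (ht ` range s)) \<le> omega"
    proof (rule cf_le_omega)
      show "ht (s n) < hat (ht ` range s)" for n
        by (rule less_hat[of _ b]) (use b in auto)
      show "\<exists>n. \<eta> \<le> ht (s n)" if "\<eta> < hat (ht ` range s)" for \<eta>
        using less_hatD[OF that] by auto
    qed
    then show "\<not> stationary_in (guess_sups (range s)) (hat (ht ` range s))"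
      if "omega < cf (hat (ht ` range s))"
      using that by simp
  qed (use s in auto)
  then show "\<exists>q\<in>S_star. \<forall>n. S_le q (s n)"
    unfolding tight_bound_def by blast
qed

end

section \<open>Strategic closure\<close>

text \<open>Even passes with \<open>None\<close> until a proper condition has been played. Only the
  set of earlier moves matters, since legal moves form a chain; that the choice succeeds is proved
  in \<open>even_tight_bound\<close>.\<close>

definition tight_strategy :: "('a::wellorder \<rightharpoonup> 'a cond option) \<Rightarrow> 'a cond option" where
  "tight_strategy m = (if \<exists>p. Some p \<in> ran m then Some (SOME q. tight_bound {p. Some p \<in> ran m} q) else None)"

locale tight_play = regular_uncountable dummy for dummy :: "'a::wellorder itself" +
  fixes x :: "'a \<Rightarrow> 'a cond option"
  assumes even_move: "even_stage \<xi> \<Longrightarrow> x \<xi> = tight_strategy ((\<lambda>\<eta>. Some (x \<eta>)) |` {..<\<xi>})"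
begin

abbreviation legal :: "'a \<Rightarrow> bool" where
  "legal \<equiv> legal_at (adjoin_top S_star) (adjoin_top_le S_le) None x"

definition played :: "'a \<Rightarrow> 'a cond set" where
  "played \<xi> = {p. \<exists>\<eta><\<xi>. x \<eta> = Some p}"

lemma even_move_eq:
  assumes "even_stage \<xi>"
  shows "x \<xi> = (if played \<xi> = {} then None else Some (SOME q. tight_bound (played \<xi>) q))"
proof -
  have "{p. Some p \<in> ran ((\<lambda>\<eta>. Some (x \<eta>)) |` {..<\<xi>})} = played \<xi>"
    by (auto simp: ran_def restrict_map_def played_def)
  with even_move[OF assms] show ?thesis
    unfolding tight_strategy_def by auto
qed

lemma legal_cond: "legal \<xi> \<Longrightarrow> x \<xi> = Some p \<Longrightarrow> p \<in> S_star"
  by (auto simp: legal_at_def adjoin_top_def)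

text \<open>The formal maximum is not below any proper condition, so it cannot be played legally
  once a proper condition has appeared.\<close>

lemma legal_le:
  assumes "legal \<xi>" "\<eta> \<le> \<xi>" "x \<eta> = Some p"
  shows "\<exists>q. x \<xi> = Some q \<and> S_le q p"
proof (cases "\<eta> = \<xi>")
  case True
  then show ?thesis
    using assms legal_cond S_le_refl by auto
next
  case False
  then have "\<eta> < \<xi>"
    using assms(2) by simp
  then have "adjoin_top_le S_le (x \<xi>) (x \<eta>)"
    using assms(1) unfolding legal_at_def by blast
  with assms(3) show ?thesis
    by (auto simp: adjoin_top_le_def split: option.splits)
qed

context
  fixes \<xi>
  assumes legal_below: "\<eta> < \<xi> \<Longrightarrow> legal \<eta>"
begin

lemma played_S_star: "played \<xi> \<subseteq> S_star"
  using legal_below legal_cond by (auto simp: played_def)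

lemma played_mono_ht:
  assumes "x \<eta> = Some p" "x \<zeta> = Some q" "\<eta> \<le> \<zeta>" "\<zeta> < \<xi>"
  shows "S_le q p" "ht p \<le> ht q"
proof -
  show "S_le q p"
    using legal_le[OF legal_below[OF assms(4)] assms(3,1)] assms(2) by simp
  moreover have "p \<in> S_star" "q \<in> S_star"
    using assms legal_below legal_cond by (meson le_less_trans)+
  ultimately show "ht p \<le> ht q"
    using S_le_ht by blast
qed

lemma played_chain:
  assumes "p \<in> played \<xi>" "q \<in> played \<xi>"
  shows "S_le p q \<or> S_le q p"
proof -
  obtain \<eta> \<zeta> where "\<eta> < \<xi>" "x \<eta> = Some p" "\<zeta> < \<xi>" "x \<zeta> = Some q"
    using assms by (auto simp: played_def)
  then show ?thesis
    using played_mono_ht(1) by (metis linear)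
qed

text \<open>Fewer than \<alpha> moves have been made, so regularity of \<alpha> bounds their
  heights.\<close>

lemma ht_played_bounded: "\<exists>b. \<forall>p\<in>played \<xi>. ht p < b"
proof -
  obtain b where b: "\<forall>\<eta><\<xi>. ht (the (x \<eta>)) < b"
    using image_bounded[of \<xi> "\<lambda>\<eta>. ht (the (x \<eta>))"] by (elim exE)
  have "ht p < b" if p: "p \<in> played \<xi>" for p
  proof -
    obtain \<eta> where \<eta>: "\<eta> < \<xi>" "x \<eta> = Some p"
      using p by (auto simp: played_def)
    have "ht (the (x \<eta>)) < b"
      using b \<eta>(1) by blast
    with \<eta>(2) show ?thesis
      by simp
  qed
  then show ?thesis
    by blast
qed

lemma ht_played_less_hat:
  assumes "p \<in> played \<xi>"
  shows "ht p < hat (ht ` played \<xi>)"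
proof -
  obtain b where "\<forall>p\<in>played \<xi>. ht p < b"
    using ht_played_bounded by (elim exE)
  with assms show ?thesis
    by (intro less_hat[of _ b]) auto
qed

end

text \<open>The heights of Even's moves form a club in the supremum of the heights of all moves, because
  Even's move at a limit stage has the supremum of the earlier heights as its height.  No
  supremum of a guessed set lies in this club.\<close>

lemma played_not_stationary:
  assumes legal: "\<And>\<eta>. \<eta> < \<xi> \<Longrightarrow> legal \<eta>" and nonempty: "played \<xi> \<noteq> {}"
    and even: "\<And>\<eta>. \<eta> < \<xi> \<Longrightarrow> even_stage \<eta> \<Longrightarrow> played \<eta> \<noteq> {} \<Longrightarrow>
      \<exists>q. x \<eta> = Some q \<and> tight_bound (played \<eta>) q"
    and cf: "omega < cf (hat (ht ` played \<xi>))"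
  shows "\<not> stationary_in (guess_sups (played \<xi>)) (hat (ht ` played \<xi>))"
proof -
  let ?\<gamma> = "hat (ht ` played \<xi>)"
  \<comment> \<open>Membership refers to tightness and not to the parity of the stage: tightness
    alone keeps a height out of \<open>guess_sups\<close>. Moves of Odd may contribute too.\<close>
  let ?C = "ht ` {q \<in> played \<xi>. \<exists>B. tight_bound B q}"
  have less_hat: "ht p < hat (ht ` played \<eta>)" if "\<eta> \<le> \<xi>" "p \<in> played \<eta>" for \<eta> p
    by (rule ht_played_less_hat[OF _ that(2)]) (use legal that(1) in \<open>meson less_le_trans\<close>)
  \<comment> \<open>A last move would have the greatest height, making the strict supremum a
    successor, of countable cofinality.\<close>
  have not_succ: "\<xi> \<noteq> osucc \<eta>" for \<eta>
  proof
    assume \<xi>: "\<xi> = osucc \<eta>"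
    obtain p \<zeta> where "x \<zeta> = Some p" "\<zeta> < \<xi>"
      using nonempty by (auto simp: played_def)
    then obtain q where q: "x \<eta> = Some q"
      using legal_le[of \<eta> \<zeta> p] legal \<xi> by auto
    have max: "ht r \<le> ht q" if r: "r \<in> played \<xi>" for r
    proof -
      obtain \<zeta> where \<zeta>: "\<zeta> < \<xi>" "x \<zeta> = Some r"
        using r by (auto simp: played_def)
      then show ?thesis
        using played_mono_ht(2)[of \<xi>, OF legal \<zeta>(2) q] \<xi> by simp
    qed
    have "q \<in> played \<xi>"
      using q \<xi> by (auto simp: played_def)
    have "cf ?\<gamma> \<le> omega"
    proof (rule cf_le_omega[of "\<lambda>_. ht q"])
      show "ht q < ?\<gamma>"
        using less_hat \<open>q \<in> played \<xi>\<close> by blast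
      show "\<exists>n. \<delta> \<le> ht q" if "\<delta> < ?\<gamma>" for \<delta>
        using less_hatD[OF that] max by (auto intro: order_trans)
    qed
    with cf show False
      by simp
  qed
  have osucc_less: "osucc \<eta> < \<xi>" if "\<eta> < \<xi>" for \<eta>
    using that not_succ[of \<eta>] by (metis osucc_le le_neq_trans)
  have unbounded: "\<exists>\<delta>\<in>?C. \<eta> \<le> \<delta>" if \<eta>: "\<eta> < ?\<gamma>" for \<eta>
  proof -
    obtain p where "p \<in> played \<xi>" "\<eta> \<le> ht p"
      using less_hatD[OF \<eta>] by auto
    then obtain \<zeta> where \<zeta>: "\<zeta> < \<xi>" "x \<zeta> = Some p"
      by (auto simp: played_def)
    \<comment> \<open>One of the next two stages after \<zeta> is even, and both lie below \<xi>
      because \<xi> is not a successor.\<close>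
    obtain \<zeta>' where \<zeta>': "\<zeta> < \<zeta>'" "\<zeta>' < \<xi>" "even_stage \<zeta>'"
      using even_or_even_osucc[of "osucc \<zeta>"] osucc_less \<zeta>(1) by (metis less_osucc order_refl less_imp_le)
    then have p: "p \<in> played \<zeta>'"
      using \<zeta> by (auto simp: played_def)
    then obtain q where q: "x \<zeta>' = Some q" "tight_bound (played \<zeta>') q"
      using even \<zeta>' by blast
    then have "ht p < ht q"
      using less_hat[OF _ p] \<zeta>'(2) by (simp add: tight_bound_def)
    moreover have "q \<in> played \<xi>"
      using q \<zeta>'(2) by (auto simp: played_def)
    ultimately show ?thesis
      using q(2) \<open>\<eta> \<le> ht p\<close> by (intro bexI[of _ "ht q"]) auto
  qed
  have closed: "\<delta> \<in> ?C" if \<delta>: "\<delta> < ?\<gamma>" "limit_point ?C \<delta>" for \<delta>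
  proof -
    \<comment> \<open>Take the first stage whose move has height at least \<delta>. Earlier heights
      are below \<delta> and, as \<delta> is a limit point, cofinal in it; so this stage turns out
      to be a limit, and Even's move there has height exactly \<delta>.\<close>
    let ?P = "\<lambda>\<zeta>. \<exists>p. x \<zeta> = Some p \<and> \<delta> \<le> ht p"
    define \<zeta> where "\<zeta> = (LEAST \<zeta>. ?P \<zeta>)"
    obtain p0 where "p0 \<in> played \<xi>" "\<delta> \<le> ht p0"
      using less_hatD[OF \<delta>(1)] by auto
    then obtain \<zeta>0 where \<zeta>0: "\<zeta>0 < \<xi>" "?P \<zeta>0"
      by (auto simp: played_def)
    have "?P \<zeta>"
      unfolding \<zeta>_def using \<zeta>0(2) by (rule LeastI)
    then obtain p where p: "x \<zeta> = Some p" "\<delta> \<le> ht p"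
      by blast
    have "\<zeta> \<le> \<zeta>0"
      unfolding \<zeta>_def using \<zeta>0(2) by (rule Least_le)
    then have "\<zeta> < \<xi>"
      using \<zeta>0(1) by simp
    have small: "ht q < \<delta>" if q: "q \<in> played \<zeta>" for q
    proof -
      obtain \<eta> where "\<eta> < \<zeta>" "x \<eta> = Some q"
        using q by (auto simp: played_def)
      then show ?thesis
        using not_less_Least[of \<eta> ?P] unfolding \<zeta>_def by auto
    qed
    have above: "\<exists>q\<in>played \<zeta>. \<eta> < ht q" if \<eta>: "\<eta> < \<delta>" for \<eta>
    proof -
      obtain q where q: "q \<in> played \<xi>" "\<eta> < ht q" "ht q < \<delta>"
        using \<delta>(2) \<eta> unfolding limit_point_def by auto
      then obtain \<zeta>1 where \<zeta>1: "\<zeta>1 < \<xi>" "x \<zeta>1 = Some q"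
        by (auto simp: played_def)
      have "\<zeta>1 < \<zeta>"
      proof (rule ccontr)
        assume "\<not> \<zeta>1 < \<zeta>"
        then have "ht p \<le> ht q"
          using played_mono_ht(2)[of \<xi>, OF legal p(1) \<zeta>1(2)] \<zeta>1(1) by simp
        with p(2) q(3) show False
          by simp
      qed
      with \<zeta>1(2) q(2) show ?thesis
        by (auto simp: played_def)
    qed
    obtain \<eta>0 where "\<eta>0 < \<delta>"
      using \<delta>(2) by (auto simp: limit_point_def)
    then have ne: "played \<zeta> \<noteq> {}"
      using above by blast
    have "hat (ht ` played \<zeta>) = \<delta>"
    proof (rule antisym)
      show "hat (ht ` played \<zeta>) \<le> \<delta>"
        by (rule hat_le) (use small in auto)
      show "\<delta> \<le> hat (ht ` played \<zeta>)"
      proof (rule ccontr)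
        assume "\<not> \<delta> \<le> hat (ht ` played \<zeta>)"
        then obtain q where "q \<in> played \<zeta>" "hat (ht ` played \<zeta>) < ht q"
          using above by (meson not_le)
        then show False
          using less_hat[of \<zeta> q] less_imp_le[OF \<open>\<zeta> < \<xi>\<close>] by simp
      qed
    qed
    \<comment> \<open>At a successor stage the preceding move would have the greatest height below
      \<delta>, contradicting cofinality.\<close>
    moreover have "\<zeta> \<noteq> osucc \<eta>" for \<eta>
    proof
      assume \<zeta>: "\<zeta> = osucc \<eta>"
      then have "\<eta> < \<xi>"
        using \<open>\<zeta> < \<xi>\<close> less_trans[of \<eta> \<zeta> \<xi>] by simp
      obtain q \<zeta>1 where \<zeta>1: "\<zeta>1 < \<zeta>" "x \<zeta>1 = Some q"
        using ne by (auto simp: played_def)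
      then obtain r where r: "x \<eta> = Some r"
        using legal_le[of \<eta> \<zeta>1 q] legal \<zeta> \<open>\<eta> < \<xi>\<close> by auto
      then have "ht r < \<delta>"
        using small[of r] \<zeta> by (auto simp: played_def)
      then obtain q' \<zeta>2 where \<zeta>2: "\<zeta>2 < \<zeta>" "x \<zeta>2 = Some q'" "ht r < ht q'"
        using above[of "ht r"] by (auto simp: played_def)
      moreover have "ht q' \<le> ht r"
        using played_mono_ht(2)[of \<xi>, OF legal \<zeta>2(2) r] \<zeta>2(1) \<zeta> \<open>\<eta> < \<xi>\<close> by simp
      ultimately show False
        by simp
    qed
    then have "even_stage \<zeta>"
      by (intro even_stage.nonsucc) blast
    then obtain q where q: "x \<zeta> = Some q" "tight_bound (played \<zeta>) q"
      using even \<open>\<zeta> < \<xi>\<close> ne by blast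
    moreover have "q \<in> played \<xi>"
      using q(1) \<open>\<zeta> < \<xi>\<close> by (auto simp: played_def)
    ultimately show ?thesis
      by (auto simp: tight_bound_def intro!: rev_image_eqI[of q])
  qed
  have "club_in ?C ?\<gamma>"
    unfolding club_in_def closed_in_def
  proof (intro conjI allI impI)
    show "?C \<subseteq> {..<?\<gamma>}"
      using less_hat by blast
  qed (use closed unbounded in blast)+
  moreover have "guess_sups (played \<xi>) \<inter> ?C = {}"
    using ht_tight_bound_notin_guess_sups[of _ _ "played \<xi>"] played_chain[of \<xi>, OF legal] by blast
  ultimately show ?thesis
    unfolding stationary_in_def by blast
qed

text \<open>By induction, all earlier moves of Even after the first proper condition are tight
  bounds; these supply the club that makes the present choice possible.\<close>

lemma even_tight_bound:
  assumes "\<And>\<eta>. \<eta> < \<xi> \<Longrightarrow> legal \<eta>" "even_stage \<xi>" "played \<xi> \<noteq> {}"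
  shows "\<exists>q. x \<xi> = Some q \<and> tight_bound (played \<xi>) q"
  using assms
proof (induction \<xi> rule: less_induct)
  case (less \<xi>)
  obtain b where b: "\<forall>p\<in>played \<xi>. ht p < b"
    using ht_played_bounded[OF less.prems(1)] by blast
  have "\<exists>q. tight_bound (played \<xi>) q"
  proof (rule ex_tight_bound)
    show "\<not> stationary_in (guess_sups (played \<xi>)) (hat (ht ` played \<xi>))"
      if "omega < cf (hat (ht ` played \<xi>))"
    proof (rule played_not_stationary[OF less.prems(1,3) _ that])
      show "\<exists>q. x \<eta> = Some q \<and> tight_bound (played \<eta>) q"
        if "\<eta> < \<xi>" "even_stage \<eta>" "played \<eta> \<noteq> {}" for \<eta>
        using less.IH[OF that(1)] less.prems(1) that by (meson less_trans)
    qed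
  qed (use less.prems played_S_star[OF less.prems(1)] played_chain[OF less.prems(1)] b in auto)
  then show ?case
    using even_move_eq[OF less.prems(2)] less.prems(3) by (auto intro: someI_ex)
qed

text \<open>Stage \<open>0\<close> falls under the case without earlier proper conditions, where
  passing with \<open>None\<close> is the move that the rules demand.\<close>

lemma even_legal:
  assumes legal: "\<And>\<eta>. \<eta> < \<xi> \<Longrightarrow> legal \<eta>" and even: "even_stage \<xi>"
  shows "legal \<xi>"
proof (cases "played \<xi> = {}")
  case True
  then have "x \<eta> = None" if "\<eta> \<le> \<xi>" for \<eta>
  proof (cases "\<eta> = \<xi>")
    case False
    with that have "\<eta> < \<xi>"
      by simp
    with True show ?thesis
      by (cases "x \<eta>") (auto simp: played_def)
  qed (use True even_move_eq[OF even] in simp)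
  then show ?thesis
    by (auto simp: legal_at_def adjoin_top_def adjoin_top_le_def)
next
  case False
  then obtain q where q: "x \<xi> = Some q" "tight_bound (played \<xi>) q"
    using even_tight_bound legal even by blast
  have "adjoin_top_le S_le (x \<xi>) (x \<eta>)" if "\<eta> < \<xi>" for \<eta>
    using q that by (auto simp: adjoin_top_le_def tight_bound_def played_def split: option.split)
  moreover have "\<not> (\<forall>\<eta>. \<xi> \<le> \<eta>)"
    using False by (auto simp: played_def not_le)
  ultimately show ?thesis
    using q by (auto simp: legal_at_def adjoin_top_def tight_bound_def)
qed

end

context regular_uncountable
begin

lemma strategically_closed_S_star:
  "strategically_closed TYPE('a) (adjoin_top (S_star :: 'a cond set)) (adjoin_top_le S_le) None"
  unfolding strategically_closed_def
proof (intro exI[of _ tight_strategy] allI impI)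
  fix x :: "'a \<Rightarrow> 'a cond option"
  assume "\<forall>\<xi>. even_stage \<xi> \<longrightarrow> x \<xi> = tight_strategy ((\<lambda>\<eta>. Some (x \<eta>)) |` {..<\<xi>})"
  then interpret tight_play dummy x
    by unfold_locales blast
  show "even_wins (adjoin_top S_star) (adjoin_top_le S_le) None x"
    unfolding even_wins_def first_illegal_def using even_legal by blast
qed

end

section \<open>Distributivity\<close>

locale forcing_notion =
  fixes P :: "'p set" and le :: "'p \<Rightarrow> 'p \<Rightarrow> bool"
  assumes refl: "p \<in> P \<Longrightarrow> le p p"
    and trans: "p \<in> P \<Longrightarrow> q \<in> P \<Longrightarrow> r \<in> P \<Longrightarrow> le r q \<Longrightarrow> le q p \<Longrightarrow> le r p"

locale forcing_over_regular = regular_uncountable dummy + forcing_notion P le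
  for dummy :: "'a::wellorder itself" and P :: "'p set" and le :: "'p \<Rightarrow> 'p \<Rightarrow> bool"
begin

text \<open>Odd can meet a given dense open set at each of his moves.  His moves leave out half of
  the stages, so at stage \<open>\<eta> + 1\<close> he meets the sets with index \<open>\<eta>\<close> and \<open>\<eta> + 1\<close>.\<close>

lemma play_through_dense_sets:
  fixes D :: "'a \<Rightarrow> 'p set"
  assumes strat: "strategically_closed TYPE('a) (adjoin_top P) (adjoin_top_le le) None"
    and D: "\<And>\<xi>. dense_in P le (D \<xi>)" "\<And>\<xi>. open_in P le (D \<xi>)"
    and p: "p \<in> P"
  shows "\<exists>q\<in>P. le q p \<and> (\<forall>\<xi><b. q \<in> D \<xi>)"
proof -
  obtain \<sigma> :: "('a \<rightharpoonup> 'p option) \<Rightarrow> 'p option" where \<sigma>: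
    "\<And>x. (\<And>\<xi>. even_stage \<xi> \<Longrightarrow> x \<xi> = \<sigma> ((\<lambda>\<eta>. Some (x \<eta>)) |` {..<\<xi>})) \<Longrightarrow>
      even_wins (adjoin_top P) (adjoin_top_le le) None x"
    using strat unfolding strategically_closed_def by blast
  \<comment> \<open>Replacing the formal maximum by \<open>p\<close> forces Odd's first move below
    \<open>p\<close>.\<close>
  define base where "base m = (case m of None \<Rightarrow> p | Some q \<Rightarrow> q)" for m
  define good where "good m \<eta> y \<longleftrightarrow> y \<in> D \<eta> \<and> y \<in> D (osucc \<eta>) \<and> le y (base m)" for m \<eta> y
  \<comment> \<open>One step of the recursion for the play: Even follows \<sigma>, and Odd, whose
    stages are all successors, picks a good condition below the preceding move.\<close>
  define H where "H g \<xi> = (if even_stage \<xi> then \<sigma> ((\<lambda>\<eta>. Some (g \<eta>)) |` {..<\<xi>})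
    else Some (SOME y. \<exists>\<eta>. \<xi> = osucc \<eta> \<and> good (g \<eta>) \<eta> y))" for g and \<xi> :: 'a
  define x where "x = wfrec {(\<eta>, \<xi>). \<eta> < (\<xi>::'a)} H"
  have x: "x \<xi> = H (cut x {(\<eta>, \<xi>). \<eta> < \<xi>} \<xi>) \<xi>" for \<xi>
    unfolding x_def using wf by (rule wfrec)
  let ?legal = "legal_at (adjoin_top P) (adjoin_top_le le) None x"
  have "x \<xi> = \<sigma> ((\<lambda>\<eta>. Some (x \<eta>)) |` {..<\<xi>})" if "even_stage \<xi>" for \<xi>
  proof -
    have "(\<lambda>\<eta>. Some (cut x {(\<eta>, \<xi>). \<eta> < \<xi>} \<xi> \<eta>)) |` {..<\<xi>} = (\<lambda>\<eta>. Some (x \<eta>)) |` {..<\<xi>}"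
      by (auto simp: restrict_map_def cut_def)
    with that x[of \<xi>] show ?thesis
      by (simp add: H_def)
  qed
  then have wins: "even_wins (adjoin_top P) (adjoin_top_le le) None x"
    by (rule \<sigma>)
  have odd_move: "x (osucc \<eta>) = Some (SOME y. good (x \<eta>) \<eta> y)" if "\<not> even_stage (osucc \<eta>)" for \<eta>
  proof -
    have "cut x {(\<eta>, \<xi>). \<eta> < \<xi>} (osucc \<eta>) \<eta> = x \<eta>"
      by (simp add: cut_def)
    with that x[of "osucc \<eta>"] show ?thesis
      by (simp add: H_def)
  qed
  have base_P: "base (x \<eta>) \<in> P" if "?legal \<eta>" for \<eta>
    using that p by (auto simp: legal_at_def adjoin_top_def base_def)
  have legal_P: "q \<in> P" if "?legal \<eta>" "x \<eta> = Some q" for \<eta> q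
    using base_P[OF that(1)] that(2) by (simp add: base_def)
  have odd_good: "\<exists>y. x (osucc \<eta>) = Some y \<and> good (x \<eta>) \<eta> y"
    if legal: "?legal \<eta>" and odd: "\<not> even_stage (osucc \<eta>)" for \<eta>
  proof -
    obtain d where d: "d \<in> D \<eta>" "le d (base (x \<eta>))"
      using D(1)[of \<eta>] base_P[OF legal] unfolding dense_in_def by blast
    then have "d \<in> P"
      using D(2)[of \<eta>] unfolding open_in_def by blast
    then obtain e where e: "e \<in> D (osucc \<eta>)" "le e d"
      using D(1)[of "osucc \<eta>"] unfolding dense_in_def by blast
    then have "e \<in> P"
      using D(2)[of "osucc \<eta>"] unfolding open_in_def by blast
    then have "e \<in> D \<eta>" "le e (base (x \<eta>))"
      using d e D(2)[of \<eta>] trans[OF base_P[OF legal] \<open>d \<in> P\<close>] unfolding open_in_def by blast+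
    with e(1) have "good (x \<eta>) \<eta> e"
      by (simp add: good_def)
    then have "good (x \<eta>) \<eta> (SOME y. good (x \<eta>) \<eta> y)"
      by (rule someI)
    then show ?thesis
      using odd_move[OF odd] by simp
  qed
  have le_of_legal: "\<exists>q. x \<xi> = Some q \<and> le q r" if "?legal \<xi>" "\<eta> \<le> \<xi>" "x \<eta> = Some r" for \<xi> \<eta> r
  proof (cases "\<eta> = \<xi>")
    case True
    then show ?thesis
      using that refl legal_P by auto
  next
    case False
    then have "\<eta> < \<xi>"
      using that(2) by simp
    then have "adjoin_top_le le (x \<xi>) (Some r)"
      using that(1,3) unfolding legal_at_def by metis
    then show ?thesis
      by (auto simp: adjoin_top_le_def split: option.splits)
  qed
  have legal: "?legal \<xi>" for \<xi>
  proof (induction \<xi> rule: less_induct)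
    case (less \<xi>)
    show ?case
    proof (cases "even_stage \<xi>")
      case True
      with wins less show ?thesis
        unfolding even_wins_def first_illegal_def by blast
    next
      case False
      then obtain \<eta> where \<eta>: "\<xi> = osucc \<eta>"
        using even_stage.nonsucc by blast
      then have legal_\<eta>: "?legal \<eta>"
        using less by simp
      then obtain y where y: "x \<xi> = Some y" "good (x \<eta>) \<eta> y"
        using odd_good False \<eta> by blast
      then have "y \<in> P"
        using D(2)[of \<eta>] unfolding good_def open_in_def by blast
      have "adjoin_top_le le (x \<xi>) (x \<zeta>)" if "\<zeta> < \<xi>" for \<zeta>
      proof (cases "x \<zeta>")
        case (Some r)
        have "\<zeta> \<le> \<eta>"
          using that \<eta> by simp
        then obtain q where q: "x \<eta> = Some q" "le q r"
          using le_of_legal[OF legal_\<eta> _ Some] by blast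
        then have "le y q"
          using y(2) by (simp add: good_def base_def)
        then have "le y r"
          using trans[of r q y] q \<open>y \<in> P\<close> legal_P[OF legal_\<eta> q(1)] legal_P[OF less[OF that] Some] by blast
        with y(1) Some show ?thesis
          by (simp add: adjoin_top_le_def)
      qed (simp add: adjoin_top_le_def)
      moreover have "\<not> (\<forall>\<zeta>. \<xi> \<le> \<zeta>)"
        using \<eta> by (auto simp: not_less)
      ultimately show ?thesis
        using y(1) \<open>y \<in> P\<close> by (simp add: legal_at_def adjoin_top_def)
    qed
  qed
  \<comment> \<open>An odd stage beyond \<open>b\<close>: its move is a proper condition below all
    earlier ones, so by openness it stays in every dense set met before.\<close>
  obtain \<xi> where \<xi>: "b < \<xi>" "\<not> even_stage \<xi>"
    using not_even_osucc[of "osucc b"] by (metis less_osucc less_imp_le order_refl)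
  then obtain q where q: "x \<xi> = Some q"
    using odd_good[OF legal] even_stage.nonsucc by metis
  have "q \<in> P"
    using legal_P[OF legal q] .
  have meets: "q \<in> D \<eta>" if "x \<zeta> = Some y" "y \<in> D \<eta>" "\<zeta> \<le> \<xi>" for \<zeta> y \<eta>
    using le_of_legal[OF legal that(3,1)] q \<open>q \<in> P\<close> that(2) D(2)[of \<eta>] unfolding open_in_def by auto
  have "q \<in> D \<eta>" if "\<eta> < b" for \<eta>
  proof (cases "even_stage \<eta>")
    case True
    obtain y where "x (osucc \<eta>) = Some y" "good (x \<eta>) \<eta> y"
      using odd_good[OF legal not_even_osucc[OF True]] by blast
    moreover have "osucc \<eta> \<le> \<xi>"
      using \<open>\<eta> < b\<close> \<xi>(1) by simp
    ultimately show ?thesis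
      using meets by (auto simp: good_def)
  next
    case False
    then obtain \<zeta> where \<zeta>: "\<eta> = osucc \<zeta>"
      using even_stage.nonsucc by blast
    then obtain y where "x \<eta> = Some y" "good (x \<zeta>) \<zeta> y"
      using odd_good[OF legal] False by blast
    moreover have "\<eta> \<le> \<xi>"
      using \<open>\<eta> < b\<close> \<xi>(1) by simp
    ultimately show ?thesis
      using meets unfolding good_def \<zeta> by blast
  qed
  moreover have "le q p"
  \<comment> \<open>Stage \<open>0\<close> is \<open>None\<close>, so Odd's move at stage
    \<open>1\<close> is below \<open>p\<close>, and \<open>q\<close> is below that move.\<close>
  proof -
    define o0 where "o0 = (LEAST \<eta>::'a. True)"
    have o0: "o0 \<le> \<eta>" for \<eta>
      unfolding o0_def by (rule Least_le) simp
    then have "x o0 = None"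
      using legal[of o0] by (simp add: legal_at_def)
    have "even_stage o0"
      using o0 by (intro even_stage.nonsucc) (metis less_osucc not_le order_refl)
    then obtain y where y: "x (osucc o0) = Some y" "good (x o0) o0 y"
      using odd_good[OF legal not_even_osucc] by blast
    then have "le y p"
      using \<open>x o0 = None\<close> by (simp add: good_def base_def)
    moreover have "osucc o0 \<le> \<xi>"
      using o0[of b] \<xi>(1) by simp
    then have "le q y"
      using le_of_legal[OF legal _ y(1), of \<xi>] q by auto
    ultimately show ?thesis
      using trans p \<open>q \<in> P\<close> legal_P[OF legal y(1)] by blast
  qed
  ultimately show ?thesis
    using \<open>q \<in> P\<close> by blast
qed

lemma strategically_closed_imp_distributive:
  assumes "strategically_closed TYPE('a) (adjoin_top P) (adjoin_top_le le) None"
  shows "distributive_below (ord_rel :: 'a rel) P le"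
  unfolding distributive_below_def
proof (intro allI impI)
  fix \<D> :: "'p set set"
  assume \<D>: "|\<D>| <o (ord_rel :: 'a rel) \<and> (\<forall>D\<in>\<D>. dense_in P le D \<and> open_in P le D)"
  have "|UNIV :: 'a set| =o (ord_rel :: 'a rel)"
    using card_of_Field_ordIso[OF card] by simp
  then have "|\<D>| \<le>o |UNIV :: 'a set|"
    using \<D> ordLess_imp_ordLeq ordLeq_ordIso_trans ordIso_symmetric by blast
  then obtain f :: "'p set \<Rightarrow> 'a" where f: "inj_on f \<D>"
    using card_of_ordLeq[of \<D> "UNIV :: 'a set"] by blast
  obtain b where b: "\<forall>\<xi>\<in>f ` \<D>. \<xi> < b"
    using small_bounded[OF ordLeq_ordLess_trans[OF card_of_image]] \<D> by blast
  define D where "D \<xi> = (if \<xi> \<in> f ` \<D> then inv_into \<D> f \<xi> else P)" for \<xi>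
  have D_f: "D (f X) = X" if "X \<in> \<D>" for X
    using that f by (simp add: D_def)
  have "dense_in P le P" "open_in P le P"
    using refl by (auto simp: dense_in_def open_in_def)
  then have D: "dense_in P le (D \<xi>)" "open_in P le (D \<xi>)" for \<xi>
    using \<D> inv_into_into[of \<xi> f \<D>] unfolding D_def by auto
  have "\<exists>q\<in>P \<inter> \<Inter>\<D>. le q p" if p: "p \<in> P" for p
  proof -
    obtain q where q: "q \<in> P" "le q p" "\<forall>\<xi><b. q \<in> D \<xi>"
      using play_through_dense_sets[where D = D and b = b, OF assms D p] by auto
    have "q \<in> X" if "X \<in> \<D>" for X
    proof -
      have "f X < b"
        using b that by blast
      then have "q \<in> D (f X)"
        using q(3) by blast
      then show ?thesis
        using D_f[OF that] by simp
    qed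
    with q show ?thesis
      by blast
  qed
  then show "dense_in P le (P \<inter> \<Inter>\<D>)"
    by (auto simp: dense_in_def)
qed

end

section \<open>Preservation of \<open>\<alpha>\<close>\<close>

context forcing_notion
begin

lemma f_imp_iff: "f_imp P le \<phi> \<psi> p \<longleftrightarrow> (\<forall>q\<in>P. le q p \<longrightarrow> \<phi> q \<longrightarrow> (\<exists>r\<in>P. le r q \<and> \<psi> r))"
  by (auto simp: f_imp_def f_not_def f_and_def)

lemma f_ex_iff: "f_ex P le \<Phi> p \<longleftrightarrow> (\<forall>q\<in>P. le q p \<longrightarrow> (\<exists>r\<in>P. le r q \<and> (\<exists>x. \<Phi> x r)))"
  unfolding f_ex_def f_not_def f_all_def by blast

lemma f_in_mono:
  assumes "f_in P le x \<tau> p" "p \<in> P" "q \<in> P" "le q p"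
  shows "f_in P le x \<tau> q"
  using assms trans unfolding f_in_def by blast

text \<open>A ground statement does not depend on the condition, so it is true as soon as some
  stronger condition forces it.\<close>

lemma f_function_dom:
  assumes "f_function P le \<tau> \<beta> p" "p \<in> P" "q \<in> P" "le q p" "f_in P le (\<xi>, \<eta>) \<tau> q"
  shows "\<xi> < \<beta>"
  using assms unfolding f_function_def f_and_def f_all_def f_imp_iff f_ground_def by blast

lemma f_function_unique:
  assumes "f_function P le \<tau> \<beta> p" "p \<in> P" "q \<in> P" "le q p"
    "f_in P le (\<xi>, \<eta>) \<tau> q" "f_in P le (\<xi>, \<eta>') \<tau> q"
  shows "\<eta> = \<eta>'"
  using assms unfolding f_function_def f_and_def f_all_def f_imp_iff f_ground_def by blast

lemma f_function_total:
  assumes "f_function P le \<tau> \<beta> p" "p \<in> P" "q \<in> P" "le q p" "\<xi> < \<beta>"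
  shows "\<exists>r\<in>P. le r q \<and> (\<exists>\<eta>. f_in P le (\<xi>, \<eta>) \<tau> r)"
proof -
  obtain r where r: "r \<in> P" "le r q" "f_ex P le (\<lambda>\<eta>. f_in P le (\<xi>, \<eta>) \<tau>) r"
    using assms unfolding f_function_def f_and_def f_all_def f_imp_iff f_ground_def by meson
  then obtain s where "s \<in> P" "le s r" "\<exists>\<eta>. f_in P le (\<xi>, \<eta>) \<tau> s"
    unfolding f_ex_iff using refl by blast
  then show ?thesis
    using trans[OF assms(3) r(1) _ _ r(2)] by blast
qed

end

context forcing_over_regular
begin

text \<open>A condition in the intersection of the sets of conditions deciding one value each decides the
  whole function, so the values are bounded by the regularity of \<open>\<alpha>\<close> in the ground model.\<close>

lemma distributive_bounds_function:
  fixes \<tau> :: "('p \<times> ('a \<times> 'a)) set"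
  assumes dist: "distributive_below (ord_rel :: 'a rel) P le"
    and p: "p \<in> P" "f_function P le \<tau> \<beta> p"
  shows "\<exists>q\<in>P. le q p \<and> (\<exists>\<delta>. \<forall>r\<in>P. le r q \<longrightarrow> (\<forall>\<xi> \<eta>. f_in P le (\<xi>, \<eta>) \<tau> r \<longrightarrow> \<eta> < \<delta>))"
proof -
  note dom = f_function_dom[OF p(2,1)] and unique = f_function_unique[OF p(2,1)]
    and total = f_function_total[OF p(2,1)]
  \<comment> \<open>Density is required in all of \<open>P\<close>, but \<tau> is known to be a
    function only below \<open>p\<close>; conditions incompatible with \<open>p\<close> are
    therefore added.\<close>
  define D where "D \<xi> = {r \<in> P. (\<exists>\<eta>. f_in P le (\<xi>, \<eta>) \<tau> r) \<or> (\<forall>s\<in>P. le s r \<longrightarrow> \<not> le s p)}" for \<xi>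
  have "open_in P le (D \<xi>)" for \<xi>
    unfolding open_in_def
  proof (intro conjI ballI impI)
    fix r q assume r: "r \<in> D \<xi>" "q \<in> P" "le q r"
    then have "r \<in> P"
      by (simp add: D_def)
    have "le s r" if "s \<in> P" "le s q" for s
      using trans[OF \<open>r \<in> P\<close> r(2) that(1,2) r(3)] .
    moreover have "f_in P le (\<xi>, \<eta>) \<tau> q" if "f_in P le (\<xi>, \<eta>) \<tau> r" for \<eta>
      using f_in_mono[OF that \<open>r \<in> P\<close> r(2,3)] .
    ultimately show "q \<in> D \<xi>"
      using r(1,2) unfolding D_def by blast
  qed (auto simp: D_def)
  moreover have "dense_in P le (D \<xi>)" if "\<xi> < \<beta>" for \<xi>
    unfolding dense_in_def
  proof (intro conjI ballI)
    fix r assume r: "r \<in> P"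
    show "\<exists>d\<in>D \<xi>. le d r"
    proof (cases "\<exists>s\<in>P. le s r \<and> le s p")
      case True
      then obtain s where s: "s \<in> P" "le s r" "le s p"
        by blast
      then obtain d where "d \<in> P" "le d s" "\<exists>\<eta>. f_in P le (\<xi>, \<eta>) \<tau> d"
        using total \<open>\<xi> < \<beta>\<close> by blast
      then show ?thesis
        using trans[OF r s(1)] s(2) unfolding D_def by blast
    next
      case False
      then show ?thesis
        using r refl unfolding D_def by blast
    qed
  qed (auto simp: D_def)
  moreover have "|D ` {..<\<beta>}| <o (ord_rel :: 'a rel)"
    using ordLeq_ordLess_trans[OF card_of_image card_lessThan] .
  ultimately have "dense_in P le (P \<inter> \<Inter>(D ` {..<\<beta>}))"
    using dist unfolding distributive_below_def by blast
  then obtain q where "q \<in> P \<inter> \<Inter>(D ` {..<\<beta>})" "le q p"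
    using p(1) unfolding dense_in_def by metis
  then have q: "q \<in> P" "le q p" "\<And>\<xi>. \<xi> < \<beta> \<Longrightarrow> q \<in> D \<xi>"
    by auto
  \<comment> \<open>The alternative of incompatibility with \<open>p\<close> is excluded, since
    \<open>q\<close> is below \<open>p\<close>.\<close>
  have "\<exists>\<eta>. f_in P le (\<xi>, \<eta>) \<tau> q" if "\<xi> < \<beta>" for \<xi>
    using q(3)[OF that] q(1,2) refl unfolding D_def by blast
  then obtain v where v: "\<And>\<xi>. \<xi> < \<beta> \<Longrightarrow> f_in P le (\<xi>, v \<xi>) \<tau> q"
    by metis
  obtain \<delta> where \<delta>: "\<forall>\<xi><\<beta>. v \<xi> < \<delta>"
    using image_bounded[of \<beta> v] by (elim exE)
  have "\<eta> < \<delta>" if r: "r \<in> P" "le r q" "f_in P le (\<xi>, \<eta>) \<tau> r" for r \<xi> \<eta>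
  proof -
    have "le r p"
      using trans p(1) q(1,2) r(1,2) by blast
    then have "\<xi> < \<beta>"
      using dom r by blast
    then have "f_in P le (\<xi>, v \<xi>) \<tau> r"
      using f_in_mono[OF v q(1)] r by blast
    then have "\<eta> = v \<xi>"
      using unique r \<open>le r p\<close> by blast
    with \<delta> \<open>\<xi> < \<beta>\<close> show ?thesis
      by simp
  qed
  with q(1,2) show ?thesis
    by blast
qed

text \<open>The ordinal \<delta> that bounds the values serves both claims: it is missed by the
  function, and it witnesses boundedness.\<close>

lemma distributive_imp_preserves:
  assumes "distributive_below (ord_rel :: 'a rel) P le"
  shows "preserves_regular_cardinal TYPE('a) P le"
proof -
  note bounds = distributive_bounds_function[OF assms]
  have "f_cardinal TYPE('a) P le p" for p
    unfolding f_cardinal_def f_all_def f_imp_iff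
  proof (intro allI ballI impI)
    fix \<beta> and \<tau> :: "('p \<times> ('a \<times> 'a)) set" and q
    assume q: "q \<in> P" "f_function P le \<tau> \<beta> q"
    obtain r \<delta> where r: "r \<in> P" "le r q"
      "\<And>s \<xi> \<eta>. s \<in> P \<Longrightarrow> le s r \<Longrightarrow> f_in P le (\<xi>, \<eta>) \<tau> s \<Longrightarrow> \<eta> < \<delta>"
      using bounds[OF q] by blast
    have "\<not> f_ex P le (\<lambda>\<xi>. f_in P le (\<xi>, \<delta>) \<tau>) s" if s: "s \<in> P" "le s r" for s
    proof
      assume "f_ex P le (\<lambda>\<xi>. f_in P le (\<xi>, \<delta>) \<tau>) s"
      then obtain t \<xi> where t: "t \<in> P" "le t s" "f_in P le (\<xi>, \<delta>) \<tau> t"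
        unfolding f_ex_iff using refl s(1) by blast
      then have "le t r"
        using trans r(1) s by blast
      with r(3)[OF t(1) _ t(3)] show False
        by simp
    qed
    then have "f_not P le (\<lambda>p. \<forall>\<eta>. f_ex P le (\<lambda>\<xi>. f_in P le (\<xi>, \<eta>) \<tau>) p) r"
      unfolding f_not_def by blast
    with r(1,2) show "\<exists>r\<in>P. le r q \<and> f_not P le (\<lambda>p. \<forall>\<eta>. f_ex P le (\<lambda>\<xi>. f_in P le (\<xi>, \<eta>) \<tau>) p) r"
      by blast
  qed
  moreover have "f_regular TYPE('a) P le p" for p
    unfolding f_regular_def f_all_def f_imp_iff f_ground_def
  proof (intro allI ballI impI)
    fix \<beta> and \<tau> :: "('p \<times> ('a \<times> 'a)) set" and q
    assume q: "q \<in> P" "f_function P le \<tau> \<beta> q"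
    obtain r \<delta> where r: "r \<in> P" "le r q"
      "\<And>s \<xi> \<eta>. s \<in> P \<Longrightarrow> le s r \<Longrightarrow> f_in P le (\<xi>, \<eta>) \<tau> s \<Longrightarrow> \<eta> < \<delta>"
      using bounds[OF q] by blast
    let ?B = "\<lambda>\<delta> p. \<forall>\<xi> \<eta>. \<forall>q\<in>P. le q p \<longrightarrow> f_in P le (\<xi>, \<eta>) \<tau> q \<longrightarrow> (\<exists>r\<in>P. le r q \<and> \<eta> < \<delta>)"
    have "?B \<delta> s" if s: "s \<in> P" "le s r" for s
    proof (intro allI ballI impI)
      fix \<xi> \<eta> t assume t: "t \<in> P" "le t s" "f_in P le (\<xi>, \<eta>) \<tau> t"
      then have "le t r"
        using trans r(1) s by blast
      with t refl r(3) show "\<exists>r\<in>P. le r t \<and> \<eta> < \<delta>"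
        by blast
    qed
    then have "f_ex P le ?B r"
      unfolding f_ex_iff using refl by blast
    with r(1,2) show "\<exists>r\<in>P. le r q \<and> f_ex P le ?B r"
      by blast
  qed
  ultimately show ?thesis
    by (simp add: preserves_regular_cardinal_def f_and_def)
qed

end

theorem theorem2p2:
  assumes "Card_order (ord_rel :: 'a::wellorder rel)"
    and "regularCard (ord_rel :: 'a rel)"
    and "natLeq <o (ord_rel :: 'a rel)"
  shows "sigma_closed (S_star :: 'a cond set) S_le
    \<and> strategically_closed TYPE('a) (adjoin_top (S_star :: 'a cond set)) (adjoin_top_le S_le) None
    \<and> distributive_below (ord_rel :: 'a rel) (S_star :: 'a cond set) S_le
    \<and> preserves_regular_cardinal TYPE('a) (S_star :: 'a cond set) S_le"
proof -
  interpret regular_uncountable "TYPE('a)"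
    using assms by unfold_locales
  interpret forcing_over_regular "TYPE('a)" "S_star :: 'a cond set" S_le
    by unfold_locales (fact S_le_refl S_le_trans)+
  show ?thesis
    using sigma_closed_S_star strategically_closed_S_star
      strategically_closed_imp_distributive[OF strategically_closed_S_star]
      distributive_imp_preserves[OF strategically_closed_imp_distributive[OF strategically_closed_S_star]]
    by blast
qed

end
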